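(* Let $\Gamma$ be a group of Deligne-type. Assume that the following holds: for every $\|\cdot\|_{\mathrm{op}}$-asymptotic homomorphism $\varphi_n : \Gamma \to U(k_n)$, there exists a sequence of homomorphisms $\psi_n : \Gamma \to U(k_n)$ such that for all $x \in \Gamma$, $\lim_n \|\varphi_n(x) - \psi_n(x)\|_{\mathrm{HS}} = 0$. Then $\Gamma$ is not MF.
   Context: For $A \in M_n(\mathbb{C})$, $\|A\|_{\mathrm{op}}$ is the operator norm and $\|A\|_{\mathrm{HS}} = \frac{1}{\sqrt{n}} \operatorname{Tr}(A^*A)^{1/2}$ is the normalized Hilbert--Schmidt norm. $U(k)$ is the group of $k\times k$ unitary matrices. A $\|\cdot\|_{\mathrm{op}}$-asymptotic homomorphism $\varphi_n : \Gamma \to U(k_n)$ (where $(k_n)$ is any sequence of positive integers) is a sequence of maps, not necessarily homomorphisms, with $\lim_{n} \|\varphi_n(gh) - \varphi_n(g)\varphi_n(h)\|_{\mathrm{op}} = 0$ for all $g,h \in \Gamma$. A group $\Gamma$ is MF if there exist maps (not necessarily homomorphisms) $\varphi_n : \Gamma \to U(n)$, $n\in\mathbb{N}$, such that $\lim_n \|\varphi_n(gh) - \varphi_n(g)\varphi_n(h)\|_{\mathrm{op}} = 0$ for all $g,h \in \Gamma$ and $\liminf_n \|\varphi_n(g) - 1\|_{\mathrm{op}} > 0$ for all $g \in \Gamma\setminus\{1\}$. $\ker_{\mathrm{RF}}(\Gamma)$ is the kernel of the map from $\Gamma$ to its profinite completion, i.e. the set of elements of $\Gamma$ that are trivial in every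 finite quotient of $\Gamma$. A finitely generated group $\Gamma$ is of Deligne-type if there is a central element $J \in \Gamma$ of order $2$ such that $J \in \ker_{\mathrm{RF}}(\Gamma)$. *)

theory Defs
  imports
    "HOL-Algebra.Algebra"
    "Jordan_Normal_Form.Schur_Decomposition"
    "HOL-Library.Extended_Real"
    "HOL-Library.Liminf_Limsup"
begin

section \<open>Matrix norms and unitary groups\<close>

definition l2_norm :: "complex vec \<Rightarrow> real" where
  "l2_norm v = sqrt (Re (v \<bullet>c v))"

definition op_norm :: "complex mat \<Rightarrow> real" where
  "op_norm A =
     (SUP v \<in> {v \<in> carrier_vec (dim_col A). l2_norm v \<le> 1}. l2_norm (A *\<^sub>v v))"

definition mat_trace :: "complex mat \<Rightarrow> complex" where
  "mat_trace A = (\<Sum>i<dim_row A. A $$ (i, i))"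

text \<open>The trace of \<open>A\<^sup>* A\<close> is real and nonnegative, so taking its real part loses nothing.\<close>

definition HS_norm :: "complex mat \<Rightarrow> real" where
  "HS_norm A = 1 / sqrt (real (dim_row A)) * sqrt (Re (mat_trace (mat_adjoint A * A)))"

definition unitary_group :: "nat \<Rightarrow> complex mat monoid" where
  "unitary_group k =
     \<lparr> carrier = {U \<in> carrier_mat k k. mat_adjoint U * U = 1\<^sub>m k \<and> U * mat_adjoint U = 1\<^sub>m k},
       monoid.mult = (*),
       one = 1\<^sub>m k \<rparr>"


section \<open>Asymptotic homomorphisms and MF groups\<close>

definition op_asymptotic_hom ::
    "('a, 'b) monoid_scheme \<Rightarrow> (nat \<Rightarrow> nat) \<Rightarrow> (nat \<Rightarrow> 'a \<Rightarrow> complex mat) \<Rightarrow> bool" where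
  "op_asymptotic_hom G k \<phi> \<longleftrightarrow>
     (\<forall>n. k n > 0) \<and>
     (\<forall>n. \<phi> n \<in> carrier G \<rightarrow> carrier (unitary_group (k n))) \<and>
     (\<forall>g \<in> carrier G. \<forall>h \<in> carrier G.
        (\<lambda>n. op_norm (\<phi> n (g \<otimes>\<^bsub>G\<^esub> h) - \<phi> n g * \<phi> n h)) \<longlonglongrightarrow> 0)"

text \<open>The sequence of dimensions starts at \<open>1\<close>; the value of \<open>\<phi>\<close> at index \<open>0\<close> is irrelevant.\<close>

definition MF :: "('a, 'b) monoid_scheme \<Rightarrow> bool" where
  "MF G \<longleftrightarrow>
     (\<exists>\<phi> :: nat \<Rightarrow> 'a \<Rightarrow> complex mat.
        (\<forall>n\<ge>1. \<phi> n \<in> carrier G \<rightarrow> carrier (unitary_group n)) \<and>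
        (\<forall>g \<in> carrier G. \<forall>h \<in> carrier G.
           (\<lambda>n. op_norm (\<phi> n (g \<otimes>\<^bsub>G\<^esub> h) - \<phi> n g * \<phi> n h)) \<longlonglongrightarrow> 0) \<and>
        (\<forall>g \<in> carrier G - {\<one>\<^bsub>G\<^esub>}.
           liminf (\<lambda>n. ereal (op_norm (\<phi> n g - 1\<^sub>m n))) > 0))"


section \<open>Groups of Deligne type\<close>

definition ker_RF :: "('a, 'b) monoid_scheme \<Rightarrow> 'a set" where
  "ker_RF G =
     {g \<in> carrier G. \<forall>N. N \<lhd> G \<and> finite (carrier (G Mod N)) \<longrightarrow> N #>\<^bsub>G\<^esub> g = \<one>\<^bsub>G Mod N\<^esub>}"

definition finitely_generated_group :: "('a, 'b) monoid_scheme \<Rightarrow> bool" where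
  "finitely_generated_group G \<longleftrightarrow>
     group G \<and> (\<exists>S. finite S \<and> S \<subseteq> carrier G \<and> generate G S = carrier G)"

definition deligne_type :: "('a, 'b) monoid_scheme \<Rightarrow> bool" where
  "deligne_type G \<longleftrightarrow>
     finitely_generated_group G \<and>
     (\<exists>J \<in> carrier G.
        (\<forall>g \<in> carrier G. J \<otimes>\<^bsub>G\<^esub> g = g \<otimes>\<^bsub>G\<^esub> J) \<and> group.ord G J = 2 \<and> J \<in> ker_RF G)"

end

theory Submission
  imports Defs "HOL-Analysis.L2_Norm" "Jordan_Normal_Form.Spectral_Radius"
begin

text \<open>
  Suppose that \<open>\<Gamma>\<close> were MF, witnessed by \<open>\<phi>\<^sub>n\<close>, and let \<open>J\<close> be the central involution in the kernel of
  the profinite completion.  Two facts about \<open>J\<close> collide.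

  First, no finite-dimensional representation sees \<open>J\<close>.  This is Mal'cev's theorem: the matrix
  entries of a representation of a finitely generated group lie in a finitely generated subring
  \<open>A\<close> of the field, and every non-zero element of \<open>A\<close> survives in a finite quotient ring of \<open>A\<close>
  (\<open>unit_in_finite_quotient_fg\<close>, proved by adjoining one generator at a time).  Reducing the
  matrices modulo such an ideal gives a finite quotient of the group that detects every element
  acting non-trivially (\<open>trivial_on_ker_RF\<close>).  Hence \<open>\<psi> J = 1\<close> for every homomorphism
  \<open>\<psi> : \<Gamma> \<rightarrow> U(k)\<close>.

  Second, MF-ness yields an asymptotic homomorphism \<open>\<theta>\<^sub>n\<close> with \<open>\<theta>\<^sub>n(J) \<rightarrow> -1\<close> in operator norm
  (\<open>MF_involution_asymptotic_hom\<close>).  The unitary \<open>\<phi>\<^sub>n(J)\<close> almost squares to \<open>1\<close>, so it is close to a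
  symmetry \<open>1 - 2P\<close> for a projection \<open>P = V V\<^sup>*\<close>, with \<open>V\<close> an isometry
  (\<open>almost_involution_near_symmetry\<close>).  Since \<open>J\<close> stays away from \<open>1\<close>, the projection is eventually
  non-zero; since \<open>J\<close> is central, \<open>P\<close> almost commutes with every \<open>\<phi>\<^sub>n(g)\<close>.  Therefore the
  compressions \<open>V\<^sup>* \<phi>\<^sub>n(g) V\<close> are almost multiplicative and almost unitary, and polar decomposition
  (\<open>contraction_near_unitary\<close>) moves them to honest unitaries.  Passing to the corner is what makes
  the argument work in the Hilbert-Schmidt norm: in the original representation the
  \<open>(-1)\<close>-eigenspace of \<open>\<phi>\<^sub>n(J)\<close> may have vanishing relative dimension and be invisible to the
  normalized trace.

  By hypothesis, \<open>\<theta>\<^sub>n\<close> is close in Hilbert-Schmidt norm to homomorphisms \<open>\<psi>\<^sub>n\<close>, for which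
  \<open>\<psi>\<^sub>n(J) = 1\<close>.  But a matrix within operator distance \<open>1\<close> of \<open>-1\<close> has Hilbert-Schmidt distance at
  least \<open>1\<close> from \<open>1\<close> (\<open>HS_norm_minus_one_ge_1\<close>), a contradiction.
\<close>

section \<open>Finite quotients of finitely generated subrings\<close>

definition polys_over :: "'a::zero set \<Rightarrow> 'a poly set" where
  "polys_over A = {p. \<forall>i. poly.coeff p i \<in> A}"

definition adjoin :: "'a::comm_ring_1 set \<Rightarrow> 'a \<Rightarrow> 'a set" where
  "adjoin A b = (\<lambda>p. poly p b) ` polys_over A"

inductive fg_subring :: "'a::comm_ring_1 set \<Rightarrow> bool" where
  Ints: "fg_subring \<int>"
| adjoin: "fg_subring A \<Longrightarrow> fg_subring (adjoin A b)"

definition unital_subring :: "'a::comm_ring_1 set \<Rightarrow> bool" where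
  "unital_subring A \<longleftrightarrow> 1 \<in> A \<and> (\<forall>x\<in>A. \<forall>y\<in>A. x - y \<in> A \<and> x * y \<in> A)"

definition ideal_of :: "'a::comm_ring_1 set \<Rightarrow> 'a set \<Rightarrow> bool" where
  "ideal_of A I \<longleftrightarrow> I \<subseteq> A \<and> 0 \<in> I \<and> (\<forall>x\<in>I. \<forall>y\<in>I. x + y \<in> I) \<and> (\<forall>a\<in>A. \<forall>x\<in>I. a * x \<in> I)"

text \<open>Finite index is witnessed by a finite set of coset representatives, which avoids forming the
  quotient ring.\<close>

definition finite_index :: "'a::comm_ring_1 set \<Rightarrow> 'a set \<Rightarrow> bool" where
  "finite_index A I \<longleftrightarrow> (\<exists>T. finite T \<and> T \<subseteq> A \<and> (\<forall>x\<in>A. \<exists>t\<in>T. x - t \<in> I))"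

text \<open>The ring \<open>A/I\<close> is finite and non-zero, and \<open>g\<close> is invertible in it.  Invertibility,
  rather than mere non-vanishing of the residue of \<open>g\<close>, is the property that passes from a ring to
  an algebraic extension of it, where leading coefficients of polynomials have to be inverted.\<close>

definition unit_in_finite_quotient :: "'a::comm_ring_1 set \<Rightarrow> 'a \<Rightarrow> bool" where
  "unit_in_finite_quotient A g \<longleftrightarrow>
     (\<exists>I. ideal_of A I \<and> finite_index A I \<and> 1 \<notin> I \<and> (\<exists>h\<in>A. g * h - 1 \<in> I))"

lemma unital_subringD:
  assumes "unital_subring A"
  shows "1 \<in> A" "0 \<in> A" "\<And>x y. x \<in> A \<Longrightarrow> y \<in> A \<Longrightarrow> x - y \<in> A"
    "\<And>x y. x \<in> A \<Longrightarrow> y \<in> A \<Longrightarrow> x * y \<in> A" "\<And>x y. x \<in> A \<Longrightarrow> y \<in> A \<Longrightarrow> x + y \<in> A"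
    "\<And>x. x \<in> A \<Longrightarrow> - x \<in> A"  "\<And>x n. x \<in> A \<Longrightarrow> x ^ n \<in> A"
proof -
  note A = assms[unfolded unital_subring_def]
  show 1: "1 \<in> A" and d: "\<And>x y. x \<in> A \<Longrightarrow> y \<in> A \<Longrightarrow> x - y \<in> A"
    and m: "\<And>x y. x \<in> A \<Longrightarrow> y \<in> A \<Longrightarrow> x * y \<in> A" using A by auto
  show 0: "0 \<in> A" using d[OF 1 1] by simp
  show u: "\<And>x. x \<in> A \<Longrightarrow> - x \<in> A" using d[OF 0] by simp
  show "\<And>x y. x \<in> A \<Longrightarrow> y \<in> A \<Longrightarrow> x + y \<in> A" using d u by (metis diff_minus_eq_add)
  show "x ^ n \<in> A" if "x \<in> A" for x n by (induction n) (auto simp: 1 m that)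
qed

lemma unital_subring_sum:
  assumes "unital_subring A" "\<And>i. i \<in> S \<Longrightarrow> f i \<in> A"
  shows "sum f S \<in> A"
  using assms(2) by (induction S rule: infinite_finite_induct)
    (auto intro: unital_subringD[OF assms(1)])

lemma ideal_ofD:
  assumes "ideal_of A I"
  shows "I \<subseteq> A" "0 \<in> I" "\<And>x y. x \<in> I \<Longrightarrow> y \<in> I \<Longrightarrow> x + y \<in> I"
    "\<And>x y. x \<in> A \<Longrightarrow> y \<in> I \<Longrightarrow> x * y \<in> I" "\<And>x y. x \<in> I \<Longrightarrow> y \<in> A \<Longrightarrow> x * y \<in> I"
proof -
  show "I \<subseteq> A" "0 \<in> I" "\<And>x y. x \<in> I \<Longrightarrow> y \<in> I \<Longrightarrow> x + y \<in> I"
    and m: "\<And>x y. x \<in> A \<Longrightarrow> y \<in> I \<Longrightarrow> x * y \<in> I"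
    using assms unfolding ideal_of_def by auto
  show "\<And>x y. x \<in> I \<Longrightarrow> y \<in> A \<Longrightarrow> x * y \<in> I" using m by (metis mult.commute)
qed

lemma ideal_of_diff:
  assumes "unital_subring A" "ideal_of A I" "x \<in> I" "y \<in> I"
  shows "x - y \<in> I"
proof -
  have "(-1) * y \<in> I"
    by (rule ideal_ofD(4)[OF assms(2)]) (auto intro: assms unital_subringD[OF assms(1)])
  from ideal_ofD(3)[OF assms(2,3) this] show ?thesis by simp
qed

lemma ideal_of_sum:
  assumes "ideal_of A I" "\<And>i. i \<in> S \<Longrightarrow> f i \<in> I"
  shows "sum f S \<in> I"
  using assms(2) by (induction S rule: infinite_finite_induct)
    (auto intro: ideal_ofD[OF assms(1)])

lemma ideal_of_self: "unital_subring A \<Longrightarrow> ideal_of A A"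
  unfolding ideal_of_def by (auto intro: unital_subringD)

lemma unit_mod_power:
  assumes "unital_subring A" "ideal_of A I" "g \<in> A" "h \<in> A" "g * h - 1 \<in> I"
  shows "g ^ n * h ^ n - 1 \<in> I"
proof (induction n)
  case 0 then show ?case using ideal_ofD[OF assms(2)] by simp
next
  case (Suc n)
  have "g ^ Suc n * h ^ Suc n - 1 = (g * h) * (g ^ n * h ^ n - 1) + (g * h - 1)"
    by (simp add: algebra_simps)
  also have "\<dots> \<in> I"
    by (intro ideal_ofD(3,4)[OF assms(2)] Suc assms unital_subringD(4)[OF assms(1)])
  finally show ?case .
qed

lemma polys_over_const: "0 \<in> A \<Longrightarrow> a \<in> A \<Longrightarrow> [:a:] \<in> polys_over A"
  unfolding polys_over_def by (auto simp: coeff_pCons split: nat.splits)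

lemma polys_over_monom: "0 \<in> A \<Longrightarrow> a \<in> A \<Longrightarrow> Polynomial.monom a n \<in> polys_over A"
  unfolding polys_over_def by auto

lemma polys_over_add:
  "ideal_of A I \<Longrightarrow> p \<in> polys_over I \<Longrightarrow> q \<in> polys_over I \<Longrightarrow> p + q \<in> polys_over I"
  unfolding polys_over_def by (auto intro: ideal_ofD)

lemma polys_over_diff:
  "unital_subring A \<Longrightarrow> ideal_of A I \<Longrightarrow> p \<in> polys_over I \<Longrightarrow> q \<in> polys_over I \<Longrightarrow> p - q \<in> polys_over I"
  unfolding polys_over_def by (auto intro: ideal_of_diff)

lemma polys_over_mult:
  "ideal_of A I \<Longrightarrow> p \<in> polys_over A \<Longrightarrow> q \<in> polys_over I \<Longrightarrow> p * q \<in> polys_over I"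
  unfolding polys_over_def by (auto simp: coeff_mult intro!: ideal_of_sum ideal_ofD(4))

lemma polys_over_smult:
  "ideal_of A I \<Longrightarrow> a \<in> A \<Longrightarrow> q \<in> polys_over I \<Longrightarrow> smult a q \<in> polys_over I"
  unfolding polys_over_def by (auto intro!: ideal_ofD(4))

lemma poly_in_ideal:
  assumes A: "unital_subring A" and I: "ideal_of A I" and "p \<in> polys_over I" "c \<in> A"
  shows "poly p c \<in> I"
  unfolding poly_altdef using assms(3,4)
  by (auto simp: polys_over_def intro!: ideal_of_sum[OF I] ideal_ofD(5)[OF I] unital_subringD(7)[OF A])

lemma unital_subring_adjoin:
  assumes A: "unital_subring A"
  shows "unital_subring (adjoin A b)" "A \<subseteq> adjoin A b" "b \<in> adjoin A b"
proof -
  note I = ideal_of_self[OF A] and A0 = unital_subringD[OF A]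
  show "A \<subseteq> adjoin A b"
  proof
    fix a assume "a \<in> A"
    then have "[:a:] \<in> polys_over A" by (intro polys_over_const A0)
    then show "a \<in> adjoin A b" unfolding adjoin_def by (force intro: image_eqI[where x = "[:a:]"])
  qed
  then have 1: "1 \<in> adjoin A b" using A0 by auto
  have "Polynomial.monom 1 1 \<in> polys_over A" by (intro polys_over_monom A0)
  then show "b \<in> adjoin A b" unfolding adjoin_def
    by (intro image_eqI[where x = "Polynomial.monom 1 1"]) (auto simp: poly_monom)
  show "unital_subring (adjoin A b)" unfolding unital_subring_def
  proof (intro conjI ballI 1)
    fix x y assume "x \<in> adjoin A b" "y \<in> adjoin A b"
    then obtain p q where p: "p \<in> polys_over A" "x = poly p b" and q: "q \<in> polys_over A" "y = poly q b"
      unfolding adjoin_def by auto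
    show "x - y \<in> adjoin A b" unfolding adjoin_def
      by (intro image_eqI[where x = "p - q"] polys_over_diff[OF A I]) (auto simp: p q)
    show "x * y \<in> adjoin A b" unfolding adjoin_def
      by (intro image_eqI[where x = "p * q"] polys_over_mult[OF I]) (auto simp: p q)
  qed
qed

lemma unital_subring_fg: "fg_subring A \<Longrightarrow> unital_subring A"
  by (induction rule: fg_subring.induct)
    (auto simp: unital_subring_adjoin, auto simp: unital_subring_def)

lemma fg_subring_contains_finite:
  assumes "finite F"
  shows "\<exists>A. fg_subring A \<and> F \<subseteq> A"
  using assms
proof induction
  case empty then show ?case using fg_subring.Ints by blast
next
  case (insert b F)
  then obtain A where A: "fg_subring A" "F \<subseteq> A" by auto
  show ?case using fg_subring.adjoin[OF A(1), of b] A
      unital_subring_adjoin[OF unital_subring_fg[OF A(1)], of b] by blast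
qed

text \<open>Dividing by a polynomial that is not monic forces denominators, which are cleared by a power of
  its leading coefficient.  The ideal \<open>I\<close> is carried along because the division is applied both to
  arbitrary polynomials over \<open>A\<close> (with \<open>I = A\<close>) and to those with coefficients in a proper ideal.\<close>

lemma pseudo_division:
  fixes s p :: "'a::comm_ring_1 poly"
  assumes A: "unital_subring A" and I: "ideal_of A I" and s: "s \<in> polys_over A" "s \<noteq> 0"
    and p: "p \<in> polys_over I"
  shows "\<exists>k v w. v \<in> polys_over I \<and> w \<in> polys_over I \<and>
           smult (lead_coeff s ^ k) p = s * v + w \<and> (w = 0 \<or> degree w < degree s)"
  using p
proof (induction "degree p" arbitrary: p rule: less_induct)
  case less
  let ?l = "lead_coeff s" and ?m = "degree p - degree s"
  note A0 = unital_subringD[OF A] and I0 = ideal_ofD[OF I]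
  have l: "?l \<in> A" using s by (auto simp: polys_over_def)
  have zero: "0 \<in> polys_over I" using I0 by (auto simp: polys_over_def)
  consider "p = 0 \<or> degree p < degree s" | "p \<noteq> 0" "degree s = 0" | "p \<noteq> 0" "degree s \<le> degree p" "degree s > 0"
    by linarith
  then show ?case
  proof cases
    case 1
    then show ?thesis using less.prems zero by (intro exI[of _ 0] exI[of _ 0] exI[of _ p]) auto
  next
    case 2
    then obtain c where c: "s = [:c:]" by (metis degree_eq_zeroE)
    show ?thesis using less.prems zero c
      by (intro exI[of _ 1] exI[of _ p] exI[of _ 0]) auto
  next
    case 3
    define t where "t = Polynomial.monom (lead_coeff p) ?m"
    have t: "t \<in> polys_over I" unfolding t_def
      using less.prems I0 by (intro polys_over_monom) (auto simp: polys_over_def)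
    define p' where "p' = smult ?l p - s * t"
    have p': "p' \<in> polys_over I" unfolding p'_def
      by (intro polys_over_diff[OF A I] polys_over_smult[OF I] polys_over_mult[OF I] less.prems s l t)
    have deg: "degree p' < degree p"
    proof -
      have "degree (s * t) \<le> degree s + ?m"
        unfolding t_def using degree_mult_le degree_monom_le order_trans
        by (metis (no_types, opaque_lifting) add_left_mono)
      then have le: "degree p' \<le> degree p" unfolding p'_def using 3
        by (intro degree_diff_le degree_smult_le) auto
      have "poly.coeff (s * t) (degree p) = ?l * lead_coeff p"
        using 3 unfolding t_def mult.commute[of s] coeff_monom_mult by simp
      then have "poly.coeff p' (degree p) = 0" unfolding p'_def by simp
      moreover have "degree p > 0" using 3 by simp
      ultimately show ?thesis using le
        by (metis (no_types, lifting) degree_0 le_eq_less_or_eq leading_coeff_0_iff)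
    qed
    from less.hyps[OF deg p'] obtain k v w where
      vw: "v \<in> polys_over I" "w \<in> polys_over I" "smult (?l ^ k) p' = s * v + w"
        "w = 0 \<or> degree w < degree s" by blast
    have "smult (?l ^ Suc k) p = s * (v + smult (?l ^ k) t) + w"
    proof -
      have "smult (?l ^ Suc k) p = smult (?l ^ k) (p' + s * t)"
        unfolding p'_def by (simp add: mult.commute)
      also have "\<dots> = smult (?l ^ k) p' + s * smult (?l ^ k) t" by (simp add: smult_add_right)
      finally show ?thesis unfolding vw by (simp add: algebra_simps)
    qed
    moreover have "v + smult (?l ^ k) t \<in> polys_over I"
      by (intro polys_over_add[OF I] vw polys_over_smult[OF I] t A0(7) l)
    ultimately show ?thesis using vw by blast
  qed
qed

text \<open>Modulo \<open>m = 2 \<bar>z\<bar> + 1\<close> the integer \<open>z\<close> has inverse \<open>- 2 sgn z\<close>, which makes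
  the multiples of \<open>m\<close> a suitable ideal.\<close>

lemma finite_quotient_Ints:
  fixes g :: "'a::field_char_0"
  assumes "g \<in> \<int>" "g \<noteq> 0"
  shows "unit_in_finite_quotient \<int> g"
proof -
  from assms obtain z where z: "g = of_int z" "z \<noteq> 0" by (auto elim: Ints_cases)
  define m where "m = 2 * \<bar>z\<bar> + 1"
  have m: "m > 1" using z unfolding m_def by auto
  define I where "I = range (\<lambda>j. of_int (m * j) :: 'a)"
  have "ideal_of \<int> I" unfolding ideal_of_def
  proof (intro conjI ballI)
    show "I \<subseteq> \<int>" unfolding I_def by auto
    show "0 \<in> I" unfolding I_def by (intro range_eqI[of _ _ 0]) simp
    fix x y assume "x \<in> I" "y \<in> I"
    then obtain i j where "x = of_int (m * i)" "y = of_int (m * j)" unfolding I_def by auto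
    then show "x + y \<in> I" unfolding I_def
      by (intro range_eqI[of _ _ "i + j"]) (simp add: algebra_simps)
  next
    fix a x :: 'a assume "a \<in> \<int>" "x \<in> I"
    then obtain i j where "a = of_int i" "x = of_int (m * j)"
      unfolding I_def by (metis Ints_cases rangeE)
    then show "a * x \<in> I" unfolding I_def
      by (intro range_eqI[of _ _ "i * j"]) (simp add: algebra_simps)
  qed
  moreover have "finite_index \<int> I" unfolding finite_index_def
  proof (intro exI[of _ "of_int ` {0..<m}"] conjI ballI)
    fix x :: 'a assume "x \<in> \<int>"
    then obtain i where i: "x = of_int i" by (auto elim: Ints_cases)
    show "\<exists>t\<in>of_int ` {0..<m}. x - t \<in> I"
    proof (intro bexI[of _ "of_int (i mod m)"] imageI)
      have "x - of_int (i mod m) = of_int (m * (i div m))" unfolding i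
        by (metis of_int_diff minus_mod_eq_mult_div)
      then show "x - of_int (i mod m) \<in> I" unfolding I_def by blast
    qed (use m in auto)
  qed auto
  moreover have "1 \<notin> I"
  proof
    assume "1 \<in> I"
    then obtain j where "(1::'a) = of_int (m * j)" unfolding I_def by auto
    then have "m * j = 1" by (metis of_int_1 of_int_eq_iff)
    then show False using m by (simp add: zmult_eq_1_iff)
  qed
  moreover have "\<exists>h\<in>\<int>. g * h - 1 \<in> I"
  proof (intro bexI[of _ "of_int (- 2 * sgn z)"])
    have "z * (- 2 * sgn z) - 1 = m * (-1)" unfolding m_def by (auto simp: sgn_if)
    then have "g * of_int (- 2 * sgn z) - 1 = of_int (m * (-1))" unfolding z
      by (metis of_int_mult of_int_diff of_int_1)
    then show "g * of_int (- 2 * sgn z) - 1 \<in> I" unfolding I_def by blast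
  qed auto
  ultimately show ?thesis unfolding unit_in_finite_quotient_def by blast
qed

text \<open>If \<open>b\<close> is transcendental, then \<open>A[b]\<close> is a polynomial ring, and \<open>b\<close> can be specialized to an
  integer \<open>c\<close> at which the polynomial representing \<open>f\<close> does not vanish.  An ideal for the value at
  \<open>c\<close> then pulls back along the evaluation map \<open>A[b] \<rightarrow> A\<close>.\<close>

lemma finite_quotient_adjoin_transcendental:
  fixes b :: "'a::field_char_0"
  assumes A: "unital_subring A" and "\<int> \<subseteq> A"
    and IH: "\<And>g. g \<in> A \<Longrightarrow> g \<noteq> 0 \<Longrightarrow> unit_in_finite_quotient A g"
    and tr: "\<And>p. p \<in> polys_over A \<Longrightarrow> p \<noteq> 0 \<Longrightarrow> poly p b \<noteq> 0"
    and f: "f \<in> adjoin A b" "f \<noteq> 0"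
  shows "unit_in_finite_quotient (adjoin A b) f"
proof -
  note A0 = unital_subringD[OF A] and AA = ideal_of_self[OF A]
  obtain p where p: "p \<in> polys_over A" "f = poly p b" using f unfolding adjoin_def by auto
  then have "p \<noteq> 0" using f by auto
  then have "finite {x. poly p x = 0}" by (rule poly_roots_finite)
  moreover have "infinite (range (of_int :: int \<Rightarrow> 'a))"
    by (meson finite_imageD infinite_UNIV_int injI of_int_eq_iff)
  ultimately obtain c where c: "c \<in> \<int>" "poly p c \<noteq> 0"
    by (metis (mono_tags, lifting) Ints_def finite_subset mem_Collect_eq subsetI)
  have cA: "c \<in> A" using c assms(2) by auto
  \<comment> \<open>the induction hypothesis is applied to the specialization of \<open>f\<close>\<close>
  obtain I h where I: "ideal_of A I" "finite_index A I" "1 \<notin> I" and h: "h \<in> A" "poly p c * h - 1 \<in> I"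
    using IH[OF poly_in_ideal[OF A AA p(1) cA] c(2)] unfolding unit_in_finite_quotient_def by blast
  note I0 = ideal_ofD[OF I(1)]
  define I' where "I' = (\<lambda>q. poly q b) ` {q \<in> polys_over A. poly q c \<in> I}"
  have "ideal_of (adjoin A b) I'" unfolding ideal_of_def
  proof (intro conjI ballI)
    show "I' \<subseteq> adjoin A b" unfolding I'_def adjoin_def by auto
    show "0 \<in> I'" unfolding I'_def
      by (rule image_eqI[where x = 0]) (auto simp: polys_over_def I0 A0)
    fix x y assume "x \<in> I'" "y \<in> I'"
    then obtain q r where "q \<in> polys_over A" "poly q c \<in> I" "r \<in> polys_over A" "poly r c \<in> I"
      "x = poly q b" "y = poly r b" unfolding I'_def by auto
    then show "x + y \<in> I'" unfolding I'_def
      by (intro image_eqI[where x = "q + r"]) (auto simp: I0 intro: polys_over_add[OF AA])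
  next
    fix a x assume "a \<in> adjoin A b" "x \<in> I'"
    then obtain q r where "q \<in> polys_over A" "r \<in> polys_over A" "poly r c \<in> I"
      "a = poly q b" "x = poly r b" unfolding I'_def adjoin_def by auto
    then show "a * x \<in> I'" unfolding I'_def
      by (intro image_eqI[where x = "q * r"])
        (auto intro!: I0(4) polys_over_mult[OF AA] poly_in_ideal[OF A AA _ cA])
  qed
  moreover have "finite_index (adjoin A b) I'"
  proof -
    obtain T where T: "finite T" "T \<subseteq> A" "\<And>x. x \<in> A \<Longrightarrow> \<exists>t\<in>T. x - t \<in> I"
      using I(2) unfolding finite_index_def by auto
    show ?thesis unfolding finite_index_def
    proof (intro exI[of _ T] conjI ballI T(1))
      show "T \<subseteq> adjoin A b" using T(2) unital_subring_adjoin(2)[OF A] by blast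
      fix x assume "x \<in> adjoin A b"
      then obtain q where q: "q \<in> polys_over A" "x = poly q b" unfolding adjoin_def by auto
      obtain t where t: "t \<in> T" "poly q c - t \<in> I" using T(3)[OF poly_in_ideal[OF A AA q(1) cA]] by auto
      have "x - t \<in> I'" unfolding I'_def
        by (rule image_eqI[where x = "q - [:t:]"])
          (use t T q A0 in \<open>auto intro!: polys_over_diff[OF A AA] polys_over_const\<close>)
      then show "\<exists>t\<in>T. x - t \<in> I'" using t by auto
    qed
  qed
  moreover have "1 \<notin> I'"
  proof
    assume "1 \<in> I'"
    then obtain q where q: "q \<in> polys_over A" "poly q c \<in> I" "1 = poly q b" unfolding I'_def by auto
    have "q - [:1:] \<in> polys_over A" by (intro polys_over_diff[OF A AA] polys_over_const A0 q)
    moreover have "poly (q - [:1:]) b = 0" using q by simp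
    ultimately have "q = [:1:]" using tr by (metis eq_iff_diff_eq_0)
    then show False using q I by simp
  qed
  moreover have "\<exists>h\<in>adjoin A b. f * h - 1 \<in> I'"
  proof (intro bexI[of _ h])
    show "h \<in> adjoin A b" using h unital_subring_adjoin(2)[OF A] by blast
    show "f * h - 1 \<in> I'" unfolding I'_def
      by (rule image_eqI[where x = "p * [:h:] - [:1:]"])
        (use h p A0 in \<open>auto intro!: polys_over_diff[OF A AA] polys_over_mult[OF AA] polys_over_const
           simp del: mult_pCons_right simp: mult.commute\<close>)
  qed
  ultimately show ?thesis unfolding unit_in_finite_quotient_def by blast
qed

lemma unit_in_finite_quotient_mono:
  assumes "unital_subring A" "unit_in_finite_quotient A (f * g)" "f \<in> A" "g \<in> A"
  shows "unit_in_finite_quotient A f"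
  using assms(2) unital_subringD(4)[OF assms(1,4)]
  unfolding unit_in_finite_quotient_def by (metis mult.assoc)

text \<open>Over an algebraic extension every non-zero element divides a non-zero element of the base ring.
  Among all polynomials \<open>s\<close> with \<open>s(b)\<close> a non-zero multiple of \<open>f\<close>, one of least degree is
  constant: otherwise the remainder of the minimal polynomial \<open>p\<close> modulo \<open>s\<close> would be a smaller
  one.\<close>

lemma algebraic_nonzero_multiple:
  fixes b :: "'a::field"
  assumes A: "unital_subring A" and p: "p \<in> polys_over A" "p \<noteq> 0" "poly p b = 0"
    and min: "\<And>q. q \<in> polys_over A \<Longrightarrow> q \<noteq> 0 \<Longrightarrow> poly q b = 0 \<Longrightarrow> degree p \<le> degree q"
    and f: "f \<in> adjoin A b" "f \<noteq> 0"
  shows "\<exists>e u. e \<in> A \<and> e \<noteq> 0 \<and> u \<in> adjoin A b \<and> f * u = e"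
proof -
  note A0 = unital_subringD[OF A] and AA = ideal_of_self[OF A]
  let ?B = "adjoin A b"
  note B0 = unital_subringD[OF unital_subring_adjoin(1)[OF A, of b]]
  define Q where "Q = {s \<in> polys_over A. poly s b \<noteq> 0 \<and> (\<exists>u\<in>?B. poly s b = f * u)}"
  have QI: "r \<in> Q" if "r \<in> polys_over A" "poly r b \<noteq> 0" "u \<in> ?B" "poly r b = f * u" for r u
    using that unfolding Q_def by auto
  have lc: "lead_coeff s \<in> ?B" if "s \<in> polys_over A" for s
    using that unital_subring_adjoin(2)[OF A, of b] by (auto simp: polys_over_def)
  have ev: "poly s b \<in> ?B" if "s \<in> polys_over A" for s using that unfolding adjoin_def by auto
  have "Q \<noteq> {}" using f B0(1) unfolding Q_def adjoin_def by force
  then obtain s0 where s0: "s0 \<in> Q" by blast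
  define s where "s = arg_min degree (\<lambda>s. s \<in> Q)"
  have s: "s \<in> Q" unfolding s_def using s0 by (rule arg_min_natI)
  have smin: "\<And>r. r \<in> Q \<Longrightarrow> degree s \<le> degree r" unfolding s_def by (rule arg_min_nat_le)
  have sA: "s \<in> polys_over A" "poly s b \<noteq> 0" using s unfolding Q_def by simp_all
  obtain us where us: "us \<in> ?B" "poly s b = f * us"
    using s unfolding Q_def by (elim CollectE conjE bexE)
  have s0: "s \<noteq> 0" using sA by auto
  have "degree s < degree p"
  proof (rule ccontr)
    assume *: "\<not> degree s < degree p"
    obtain k v w where w: "w \<in> polys_over A" "smult (lead_coeff p ^ k) s = p * v + w"
      "w = 0 \<or> degree w < degree p" using pseudo_division[OF A AA p(1,2) sA(1)] by auto
    from arg_cong[OF w(2), of "\<lambda>q. poly q b"] have e: "poly w b = lead_coeff p ^ k * poly s b"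
      using p by simp
    then have nz: "poly w b \<noteq> 0" using p sA by simp
    moreover have "poly w b = f * (lead_coeff p ^ k * us)" unfolding e us by simp
    ultimately have "w \<in> Q" using w us lc[OF p(1)] by (intro QI[of _ "lead_coeff p ^ k * us"] B0) auto
    then show False using smin[of w] w(3) nz * by auto
  qed
  obtain k v w where vw: "v \<in> polys_over A" "w \<in> polys_over A" "smult (lead_coeff s ^ k) p = s * v + w"
      "w = 0 \<or> degree w < degree s" using pseudo_division[OF A AA sA(1) s0 p(1)] by auto
  from arg_cong[OF vw(3), of "\<lambda>q. poly q b"] have "poly s b * poly v b + poly w b = 0"
    using p by simp
  then have e: "poly w b = - poly s b * poly v b" by (metis add.inverse_unique mult_minus_left)
  have "degree s = 0"
  proof (rule ccontr)
    assume pos: "degree s \<noteq> 0"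
    have dp: "degree (smult (lead_coeff s ^ k) p) = degree p" using s0 by simp
    have v0: "v \<noteq> 0" using vw dp \<open>degree s < degree p\<close> by auto
    have "degree (s * v) = degree s + degree v" using v0 s0 by (rule degree_mult_eq[rotated])
    moreover have "degree (s * v) = degree p"
    proof -
      have "s * v = smult (lead_coeff s ^ k) p + (- w)" using vw by simp
      moreover have "degree (- w) < degree (smult (lead_coeff s ^ k) p)"
        unfolding dp using vw(4) \<open>degree s < degree p\<close> by auto
      ultimately show ?thesis using degree_add_eq_left dp by metis
    qed
    ultimately have "degree v < degree p" using pos by simp
    then have "poly v b \<noteq> 0" using min[OF vw(1) v0] by auto
    then have nz: "poly w b \<noteq> 0" using e sA by simp
    moreover have "poly w b = f * (- (us * poly v b))" unfolding e us by simp
    ultimately have "w \<in> Q" using vw us ev by (intro QI[of _ "- (us * poly v b)"] B0) auto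
    then show False using smin[of w] vw(4) nz by auto
  qed
  then obtain c where "s = [:c:]" by (metis degree_eq_zeroE)
  then have "c \<in> A" "c \<noteq> 0" "f * us = c" using sA us by (auto simp: polys_over_def coeff_pCons split: nat.splits dest: spec[of _ 0])
  then show ?thesis using us by blast
qed

text \<open>Let \<open>p\<close> have least degree among the polynomials over \<open>A\<close> that vanish at \<open>b\<close>, with leading
  coefficient \<open>l\<close>, and let \<open>e \<in> A\<close> be a non-zero multiple of \<open>f\<close>.  Choose an ideal \<open>I\<close> of \<open>A\<close> for
  \<open>l e\<close>; the ideal \<open>I A[b]\<close> does the job.  Because \<open>l\<close> is invertible modulo \<open>I\<close>, the powers of \<open>b\<close>
  below the degree of \<open>p\<close> span the quotient, which is therefore finite.  The ideal is proper: from
  \<open>1 \<in> I A[b]\<close>, division by \<open>p\<close> would express some power of \<open>l\<close> as a polynomial of small degree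
  with coefficients in \<open>I\<close>, so that this power of \<open>l\<close>, a unit modulo \<open>I\<close>, would lie in \<open>I\<close>.\<close>

lemma finite_quotient_adjoin_algebraic:
  fixes b :: "'a::field"
  assumes A: "unital_subring A"
    and IH: "\<And>g. g \<in> A \<Longrightarrow> g \<noteq> 0 \<Longrightarrow> unit_in_finite_quotient A g"
    and alg: "p \<in> polys_over A" "p \<noteq> 0" "poly p b = 0"
    and f: "f \<in> adjoin A b" "f \<noteq> 0"
  shows "unit_in_finite_quotient (adjoin A b) f"
  using alg
proof (induction "degree p" arbitrary: p rule: less_induct)
  case (less p)
  note p = less.prems
  show ?case
  proof (cases "\<exists>q. q \<in> polys_over A \<and> q \<noteq> 0 \<and> poly q b = 0 \<and> degree q < degree p")
    case True
    then show ?thesis using less.hyps by blast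
  next
    case False
    then have min: "\<And>q. q \<in> polys_over A \<Longrightarrow> q \<noteq> 0 \<Longrightarrow> poly q b = 0 \<Longrightarrow> degree p \<le> degree q"
      by (meson not_le)
    note A0 = unital_subringD[OF A] and AA = ideal_of_self[OF A]
    let ?B = "adjoin A b" and ?l = "lead_coeff p"
    note B = unital_subring_adjoin[OF A, of b]
    note B0 = unital_subringD[OF B(1)]
    obtain e u where e: "e \<in> A" "e \<noteq> 0" and u: "u \<in> ?B" "f * u = e"
      using algebraic_nonzero_multiple[OF A p min f] by blast
    have l: "?l \<in> A" "?l \<noteq> 0" using p by (auto simp: polys_over_def)
    have dpos: "degree p > 0"
    proof (rule ccontr)
      assume "\<not> ?thesis"
      then obtain c where "p = [:c:]" by (metis degree_eq_zeroE gr0I)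
      then show False using p by simp
    qed
    obtain I h where I: "ideal_of A I" "finite_index A I" "1 \<notin> I" and h: "h \<in> A" "?l * e * h - 1 \<in> I"
      using IH[of "?l * e"] l e A0 unfolding unit_in_finite_quotient_def by auto
    note I0 = ideal_ofD[OF I(1)]
    \<comment> \<open>the inverse of the leading coefficient modulo \<open>I\<close>\<close>
    define l' where "l' = e * h"
    have l': "l' \<in> A" "?l * l' - 1 \<in> I" using h e A0 unfolding l'_def by (auto simp: mult.assoc)
    note unit = unit_mod_power[OF A I(1) l(1) l']
    define I' where "I' = (\<lambda>q. poly q b) ` polys_over I"
    have "polys_over I \<subseteq> polys_over A" using I0 unfolding polys_over_def by auto
    then have I'B: "I' \<subseteq> ?B" unfolding I'_def adjoin_def by auto
    have II': "I \<subseteq> I'"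
    proof
      fix x assume "x \<in> I"
      then show "x \<in> I'" unfolding I'_def
        by (intro image_eqI[where x = "[:x:]"] polys_over_const I0) auto
    qed
    have ideal: "ideal_of ?B I'" unfolding ideal_of_def
    proof (intro conjI ballI)
      show "I' \<subseteq> adjoin A b" by fact
      show "0 \<in> I'" using II' I0 by auto
      fix x y assume "x \<in> I'" "y \<in> I'"
      then obtain q r where "q \<in> polys_over I" "r \<in> polys_over I" "x = poly q b" "y = poly r b"
        unfolding I'_def by auto
      then show "x + y \<in> I'" unfolding I'_def
        by (intro image_eqI[where x = "q + r"]) (auto intro: polys_over_add[OF I(1)])
    next
      fix a x assume "a \<in> ?B" "x \<in> I'"
      then obtain q r where "q \<in> polys_over A" "r \<in> polys_over I" "a = poly q b" "x = poly r b"
        unfolding I'_def adjoin_def by auto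
      then show "a * x \<in> I'" unfolding I'_def
        by (intro image_eqI[where x = "q * r"]) (auto intro: polys_over_mult[OF I(1)])
    qed
    note I'0 = ideal_ofD[OF ideal]
    have "finite_index ?B I'"
    proof -
      obtain T where T: "finite T" "T \<subseteq> A" "\<And>x. x \<in> A \<Longrightarrow> \<exists>t\<in>T. x - t \<in> I"
        using I(2) unfolding finite_index_def by auto
      let ?d = "degree p"
      define T' where "T' = (\<lambda>t. \<Sum>i<?d. t i * b ^ i) ` ({..<?d} \<rightarrow>\<^sub>E T)"
      show ?thesis unfolding finite_index_def
      proof (intro exI[of _ T'] conjI ballI)
        show "finite T'" unfolding T'_def by (intro finite_imageI finite_PiE T) auto
        show "T' \<subseteq> ?B" unfolding T'_def
          using T(2) B by (auto intro!: unital_subring_sum[OF B(1)] B0(4,7) simp: PiE_iff)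
        fix x assume xB: "x \<in> ?B"
        then obtain q where q: "q \<in> polys_over A" "x = poly q b" unfolding adjoin_def by auto
        obtain k v w where w: "w \<in> polys_over A" "smult (?l ^ k) q = p * v + w"
          "w = 0 \<or> degree w < ?d" using pseudo_division[OF A AA p(1,2) q(1)] by auto
        \<comment> \<open>evaluation at \<open>b\<close> kills the multiple of \<open>p\<close>, leaving a polynomial of degree below \<open>?d\<close>\<close>
        from arg_cong[OF w(2), of "\<lambda>q. poly q b"] have e: "?l ^ k * x = poly w b"
          using p q by simp
        define c where "c i = l' ^ k * poly.coeff w i" for i
        have "c i \<in> A" for i unfolding c_def using w(1) A0 l' by (auto simp: polys_over_def)
        then have "\<exists>t. t \<in> T \<and> c i - t \<in> I" for i using T(3) by blast
        then obtain t where t: "\<And>i. t i \<in> T" "\<And>i. c i - t i \<in> I" by metis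
        define y where "y = (\<Sum>i<?d. restrict t {..<?d} i * b ^ i)"
        have "poly w b = (\<Sum>i<?d. poly.coeff w i * b ^ i)"
          unfolding poly_altdef using w(3) dpos
          by (intro sum.mono_neutral_left) (auto simp: coeff_eq_0 )
        then have "l' ^ k * poly w b - y = (\<Sum>i<?d. (c i - t i) * b ^ i)"
          unfolding y_def c_def by (simp add: sum_distrib_left sum_subtractf algebra_simps)
        also have "\<dots> \<in> I'"
          by (intro ideal_of_sum[OF ideal] I'0(5) B0(7) B(3) subsetD[OF II'] t)
        finally have 1: "l' ^ k * poly w b - y \<in> I'" .
        have "(?l ^ k * l' ^ k - 1) * x \<in> I'"
          by (intro I'0(5) subsetD[OF II'] unit xB)
        from ideal_of_diff[OF B(1) ideal 1 this] have "x - y \<in> I'"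
          unfolding e[symmetric] by (simp add: algebra_simps)
        moreover have "y \<in> T'" unfolding T'_def y_def using t by (intro imageI restrict_PiE_iff[THEN iffD2]) auto
        ultimately show "\<exists>t\<in>T'. x - t \<in> I'" by blast
      qed
    qed
    moreover have "1 \<notin> I'"
    proof
      assume "1 \<in> I'"
      then obtain q where q: "q \<in> polys_over I" "1 = poly q b" unfolding I'_def by auto
      obtain k v w where w: "w \<in> polys_over I" "smult (?l ^ k) q = p * v + w"
          "w = 0 \<or> degree w < degree p" using pseudo_division[OF A I(1) p(1,2) q(1)] by auto
      from arg_cong[OF w(2), of "\<lambda>q. poly q b"] have e: "poly w b = ?l ^ k" using p q(2) by simp
      let ?r = "w - [:?l ^ k:]"
      have "w \<in> polys_over A" using w I0 unfolding polys_over_def by auto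
      then have "?r \<in> polys_over A"
        by (intro polys_over_diff[OF A AA] polys_over_const A0 l)
      moreover have "poly ?r b = 0" using e by simp
      moreover have "degree ?r < degree p" using w(3) dpos
        by (intro degree_diff_less) auto
      ultimately have "?r = 0" using min by (meson not_le)
      then have "?l ^ k = poly.coeff w 0" by simp
      then have "?l ^ k \<in> I" using w by (auto simp: polys_over_def)
      then have "?l ^ k * l' ^ k \<in> I" by (intro I0(5) A0 l')
      from ideal_of_diff[OF A I(1) this unit[of k]] I(3) show False by simp
    qed
    moreover have "\<exists>y\<in>?B. e * y - 1 \<in> I'"
      by (rule bexI[of _ "?l * h"]) (use h(2) h(1) l A0 B II' in \<open>auto simp: mult.assoc mult.left_commute\<close>)
    ultimately have "unit_in_finite_quotient ?B e"
      unfolding unit_in_finite_quotient_def using ideal by blast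
    then show ?thesis using unit_in_finite_quotient_mono[OF B(1) _ f(1) u(1)] u(2) by simp
  qed
qed

theorem unit_in_finite_quotient_fg:
  fixes A :: "'a::field_char_0 set"
  assumes "fg_subring A" "g \<in> A" "g \<noteq> 0"
  shows "unit_in_finite_quotient A g"
  using assms
proof (induction arbitrary: g rule: fg_subring.induct)
  case Ints
  then show ?case by (rule finite_quotient_Ints)
next
  case (adjoin A b)
  note A = unital_subring_fg[OF adjoin.hyps]
  have Z: "\<int> \<subseteq> A" using adjoin.hyps
    by induction (use unital_subring_adjoin(2)[OF unital_subring_fg] in blast)+
  show ?case
  proof (cases "\<exists>p \<in> polys_over A. p \<noteq> 0 \<and> poly p b = 0")
    case True
    then obtain p where p: "p \<in> polys_over A" "p \<noteq> 0" "poly p b = 0" by auto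
    show ?thesis by (rule finite_quotient_adjoin_algebraic[OF A adjoin.IH p adjoin.prems])
  next
    case False
    then show ?thesis
      by (intro finite_quotient_adjoin_transcendental[OF A Z adjoin.IH _ adjoin.prems]) auto
  qed
qed

section \<open>Residual finiteness of linear groups\<close>

definition entries_in :: "'a set \<Rightarrow> 'a mat \<Rightarrow> bool" where
  "entries_in A M \<longleftrightarrow> (\<forall>i<dim_row M. \<forall>j<dim_col M. M $$ (i, j) \<in> A)"

lemma mult_mat_sum:
  "A \<in> carrier_mat n m \<Longrightarrow> B \<in> carrier_mat m k \<Longrightarrow> i < n \<Longrightarrow> j < k \<Longrightarrow>
     (A * B) $$ (i, j) = (\<Sum>l<m. A $$ (i, l) * B $$ (l, j))"
  by (auto simp: scalar_prod_def lessThan_atLeast0 intro!: sum.cong)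

lemma entries_in_mult:
  assumes "unital_subring A" "M \<in> carrier_mat n m" "N \<in> carrier_mat m k" "entries_in A M" "entries_in A N"
  shows "entries_in A (M * N)"
  using assms(2-) unfolding entries_in_def
  by (auto simp: mult_mat_sum[OF assms(2,3)] simp del: index_mult_mat(1)
      intro!: unital_subring_sum[OF assms(1)] unital_subringD[OF assms(1)])

lemma entries_in_ideal_mult_right:
  assumes "ideal_of A I" "M \<in> carrier_mat n m" "N \<in> carrier_mat m k" "entries_in I M" "entries_in A N"
  shows "entries_in I (M * N)"
  using assms(2-) unfolding entries_in_def
  by (auto simp: mult_mat_sum[OF assms(2,3)] simp del: index_mult_mat(1)
      intro!: ideal_of_sum[OF assms(1)] ideal_ofD(5)[OF assms(1)])

lemma entries_in_ideal_mult_left: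
  assumes "ideal_of A I" "M \<in> carrier_mat n m" "N \<in> carrier_mat m k" "entries_in A M" "entries_in I N"
  shows "entries_in I (M * N)"
  using assms(2-) unfolding entries_in_def
  by (auto simp: mult_mat_sum[OF assms(2,3)] simp del: index_mult_mat(1)
      intro!: ideal_of_sum[OF assms(1)] ideal_ofD(4)[OF assms(1)])

lemma entries_in_ideal_add:
  assumes "ideal_of A I" "M \<in> carrier_mat n m" "N \<in> carrier_mat n m" "entries_in I M" "entries_in I N"
  shows "entries_in I (M + N)"
  using assms(2-) unfolding entries_in_def
  by (auto intro!: ideal_ofD(3)[OF assms(1)])

lemma entries_in_one: "unital_subring A \<Longrightarrow> entries_in A (1\<^sub>m k)"
  unfolding entries_in_def by (auto simp: one_mat_def unital_subringD)

lemma finite_image_factors: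
  assumes "finite (F ` A)" "\<And>x y. x \<in> A \<Longrightarrow> y \<in> A \<Longrightarrow> F x = F y \<Longrightarrow> h x = h y"
  shows "finite (h ` A)"
proof -
  have "h ` A \<subseteq> (\<lambda>z. h (inv_into A F z)) ` (F ` A)"
  proof
    fix y assume "y \<in> h ` A"
    then obtain x where x: "x \<in> A" "y = h x" by auto
    have "h x = h (inv_into A F (F x))"
      using x by (intro assms(2)) (auto simp: f_inv_into_f inv_into_into)
    then show "y \<in> (\<lambda>z. h (inv_into A F z)) ` (F ` A)" using x by auto
  qed
  then show ?thesis using assms(1) finite_subset by blast
qed

locale matrix_representation = group G for G (structure) +
  fixes \<rho> :: "'a \<Rightarrow> 'f::field_char_0 mat" and k :: nat
  assumes carr: "g \<in> carrier G \<Longrightarrow> \<rho> g \<in> carrier_mat k k"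
    and rep_mult: "g \<in> carrier G \<Longrightarrow> h \<in> carrier G \<Longrightarrow> \<rho> (g \<otimes> h) = \<rho> g * \<rho> h"
    and rep_one: "\<rho> \<one> = 1\<^sub>m k"
begin

text \<open>The inverses of the generators have to contribute their entries too, since the ring need not
  contain the inverse of a determinant.\<close>

lemma entries_in_fg_subring:
  assumes "finite S" "S \<subseteq> carrier G" "generate G S = carrier G"
  shows "\<exists>A. fg_subring A \<and> (\<forall>g \<in> carrier G. entries_in A (\<rho> g))"
proof -
  define F where "F = (\<Union>s \<in> S \<union> (\<lambda>s. inv s) ` S. elements_mat (\<rho> s))"
  have "finite F" unfolding F_def elements_mat_def using assms(1) by auto
  then obtain A where A: "fg_subring A" "F \<subseteq> A" using fg_subring_contains_finite by blast
  note A' = unital_subring_fg[OF A(1)]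
  have S: "entries_in A (\<rho> s)" if "s \<in> S \<union> (\<lambda>s. inv s) ` S" for s
    using A(2) that unfolding F_def entries_in_def elements_mat_def by force
  have "entries_in A (\<rho> g)" if "g \<in> generate G S" for g
    using that
  proof induction
    case one show ?case unfolding rep_one by (rule entries_in_one[OF A'])
  next
    case (eng g h)
    then have "g \<in> carrier G" "h \<in> carrier G" using assms(3) by auto
    then show ?case unfolding rep_mult[OF \<open>g \<in> carrier G\<close> \<open>h \<in> carrier G\<close>]
      by (intro entries_in_mult[OF A' carr carr] eng)
  qed (auto intro: S)
  then show ?thesis using A(1) assms(3) by auto
qed

text \<open>The principal congruence subgroup of level \<open>I\<close>: there are only finitely many matrices modulo \<open>I\<close>,
  and two group elements with congruent matrices lie in the same coset.\<close>

lemma congruence_subgroup: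
  assumes A: "unital_subring A" and I: "ideal_of A I" "finite_index A I"
    and ent: "\<And>g. g \<in> carrier G \<Longrightarrow> entries_in A (\<rho> g)"
  defines "N \<equiv> {g \<in> carrier G. entries_in I (\<rho> g - 1\<^sub>m k)}"
  shows "N \<lhd> G" "finite (carrier (G Mod N))"
proof -
  have z: "entries_in I (1\<^sub>m k - 1\<^sub>m k)" using ideal_ofD(2)[OF I(1)] by (auto simp: entries_in_def)
  \<comment> \<open>congruent elements lie in the same coset of \<open>N\<close>\<close>
  have cong: "g \<otimes> inv h \<in> N" if gh: "g \<in> carrier G" "h \<in> carrier G" and e: "entries_in I (\<rho> g - \<rho> h)" for g h
  proof -
    have ih: "inv h \<in> carrier G" using gh by simp
    have "\<rho> (g \<otimes> inv h) - 1\<^sub>m k = (\<rho> g - \<rho> h) * \<rho> (inv h)"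
      using gh ih minus_mult_distrib_mat[OF carr carr carr[OF ih], of g h]
      by (simp add: rep_mult[symmetric] rep_one)
    moreover have "entries_in I \<dots>"
      by (rule entries_in_ideal_mult_right[OF I(1) _ carr[OF ih] e ent[OF ih], where n = k])
        (intro minus_carrier_mat carr gh)
    ultimately show ?thesis unfolding N_def using gh by auto
  qed
  have mem: "entries_in I (\<rho> (g \<otimes> h) - \<rho> h)" if gh: "g \<in> N" "h \<in> carrier G" for g h
  proof -
    have g: "g \<in> carrier G" using gh N_def by auto
    have "\<rho> (g \<otimes> h) - \<rho> h = (\<rho> g - 1\<^sub>m k) * \<rho> h"
      using minus_mult_distrib_mat[OF carr[OF g] one_carrier_mat carr[OF gh(2)]] gh g carr[OF gh(2)]
      by (simp add: rep_mult)
    moreover have "entries_in I \<dots>"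
      by (rule entries_in_ideal_mult_right[OF I(1) _ carr[OF gh(2)] _ ent[OF gh(2)], where n = k])
        (use gh in \<open>auto simp: N_def intro: minus_carrier_mat\<close>)
    ultimately show ?thesis by simp
  qed
  have minus: "entries_in I (M - L)" if "entries_in I (M - K)" "entries_in I (L - K)"
    "M \<in> carrier_mat k k" "L \<in> carrier_mat k k" "K \<in> carrier_mat k k" for M L K :: "'f mat"
    unfolding entries_in_def
  proof (intro allI impI)
    fix i j assume ij: "i < dim_row (M - L)" "j < dim_col (M - L)"
    then have "(M $$ (i,j) - K $$ (i,j)) - (L $$ (i,j) - K $$ (i,j)) \<in> I"
      using that by (intro ideal_of_diff[OF A I(1), of "M $$ (i,j) - K $$ (i,j)" "L $$ (i,j) - K $$ (i,j)"])
        (simp_all add: entries_in_def)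
    then show "(M - L) $$ (i,j) \<in> I" using ij that by simp
  qed
  have sub: "subgroup N G"
  proof (rule subgroupI)
    show "N \<subseteq> carrier G" unfolding N_def by auto
    have "\<one> \<in> N" unfolding N_def using z by (simp add: rep_one)
    then show "N \<noteq> {}" by auto
    show "inv g \<in> N" if g: "g \<in> N" for g
    proof -
      have gc: "g \<in> carrier G" using g N_def by auto
      have "entries_in I (\<rho> \<one> - \<rho> g)"
        by (rule minus[where K = "\<rho> \<one>"]) (use g z gc carr in \<open>auto simp: N_def rep_one\<close>)
      from cong[OF one_closed gc this] show ?thesis using gc by simp
    qed
    show "g \<otimes> h \<in> N" if g: "g \<in> N" and h: "h \<in> N" for g h
    proof -
      have gc: "g \<in> carrier G" "h \<in> carrier G" using g h N_def by auto
      have "entries_in I ((\<rho> (g \<otimes> h) - \<rho> h) + (\<rho> h - 1\<^sub>m k))"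
        by (rule entries_in_ideal_add[OF I(1) _ _ mem[OF g gc(2)], where n = k and m = k]) (use h gc carr in \<open>auto simp: N_def intro: minus_carrier_mat\<close>)
      moreover have "(\<rho> (g \<otimes> h) - \<rho> h) + (\<rho> h - 1\<^sub>m k) = \<rho> (g \<otimes> h) - 1\<^sub>m k"
        using carr gc by (intro eq_matI) (auto simp: carrier_matD[OF carr])
      ultimately show ?thesis unfolding N_def using gc by auto
    qed
  qed
  show "N \<lhd> G" unfolding normal_inv_iff
  proof (intro conjI sub ballI)
    fix x h assume x: "x \<in> carrier G" and h: "h \<in> N"
    have hc: "h \<in> carrier G" using h N_def by auto
    have xh: "x \<otimes> h \<in> carrier G" using x hc by auto
    have "\<rho> (x \<otimes> h) - \<rho> x = \<rho> x * (\<rho> h - 1\<^sub>m k)"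
      using mult_minus_distrib_mat[OF carr[OF x] carr[OF hc] one_carrier_mat] x hc carr[OF x] by (simp add: rep_mult)
    moreover have "entries_in I \<dots>"
      by (rule entries_in_ideal_mult_left[OF I(1) carr[OF x] _ ent[OF x], where k = k])
        (use h hc carr in \<open>auto simp: N_def intro: minus_carrier_mat\<close>)
    ultimately show "x \<otimes> h \<otimes> inv x \<in> N" using cong[OF xh x] by simp
  qed
  obtain T where T: "finite T" "\<And>x. x \<in> A \<Longrightarrow> \<exists>t\<in>T. x - t \<in> I"
    using I(2) unfolding finite_index_def by auto
  then have "\<forall>x. \<exists>t. x \<in> A \<longrightarrow> t \<in> T \<and> x - t \<in> I" by blast
  then obtain r where r: "\<And>x. x \<in> A \<Longrightarrow> r x \<in> T \<and> x - r x \<in> I" by metis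
  have entA: "\<rho> g $$ (i, j) \<in> A" if "g \<in> carrier G" "i < k" "j < k" for g i j
    using ent[OF that(1)] carr[OF that(1)] that(2,3) by (auto simp: entries_in_def)
  define F where "F g = restrict (\<lambda>ij. r (\<rho> g $$ ij)) ({..<k} \<times> {..<k})" for g
  have "F ` carrier G \<subseteq> ({..<k} \<times> {..<k}) \<rightarrow>\<^sub>E T"
    using r entA unfolding F_def by (intro image_subsetI) (auto simp only: restrict_PiE_iff mem_Sigma_iff lessThan_iff)
  then have "finite (F ` carrier G)" by (rule finite_subset) (auto intro!: finite_PiE T)
  moreover have "N #> g = N #> h" if gh: "g \<in> carrier G" "h \<in> carrier G" and e: "F g = F h" for g h
  proof -
    \<comment> \<open>equal chosen representatives mean congruent entries\<close>
    have "entries_in I (\<rho> g - \<rho> h)" unfolding entries_in_def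
    proof (intro allI impI)
      fix i j assume "i < dim_row (\<rho> g - \<rho> h)" "j < dim_col (\<rho> g - \<rho> h)"
      then have ij: "i < k" "j < k" using carr[OF gh(2)] by auto
      from fun_cong[OF e, of "(i,j)"] ij have e': "r (\<rho> g $$ (i,j)) = r (\<rho> h $$ (i,j))" unfolding F_def by simp
      have "\<rho> g $$ (i,j) \<in> A" "\<rho> h $$ (i,j) \<in> A" by (intro entA gh ij)+
      from ideal_of_diff[OF A I(1) r[OF this(1), THEN conjunct2] r[OF this(2), THEN conjunct2]]
      show "(\<rho> g - \<rho> h) $$ (i,j) \<in> I" using ij carr[OF gh(1)] carr[OF gh(2)] e' by simp
    qed
    from cong[OF gh this] have n: "g \<otimes> inv h \<in> N" .
    have "g = (g \<otimes> inv h) \<otimes> h" using gh by (simp add: inv_solve_right m_assoc)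
    then have "g \<in> N #> h" using n unfolding r_coset_def by blast
    from repr_independence[OF this gh(2) sub] show ?thesis by simp
  qed
  ultimately have "finite ((\<lambda>g. N #> g) ` carrier G)" by (rule finite_image_factors)
  moreover have "carrier (G Mod N) = (\<lambda>g. N #> g) ` carrier G"
    unfolding FactGroup_def RCOSETS_def by auto
  ultimately show "finite (carrier (G Mod N))" by simp
qed

text \<open>If \<open>\<rho> x \<noteq> 1\<close>, some entry \<open>a\<close> of \<open>\<rho> x - 1\<close> is non-zero.  Modulo an ideal in which \<open>a\<close> is a unit, \<open>x\<close>
  is not in the congruence subgroup, although \<open>x\<close> dies in every finite quotient.\<close>

theorem trivial_on_ker_RF:
  assumes "finitely_generated_group G" "x \<in> ker_RF G"
  shows "\<rho> x = 1\<^sub>m k"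
proof (rule ccontr)
  assume neq: "\<rho> x \<noteq> 1\<^sub>m k"
  have x: "x \<in> carrier G" using assms(2) unfolding ker_RF_def by auto
  obtain A where A: "fg_subring A" "\<And>g. g \<in> carrier G \<Longrightarrow> entries_in A (\<rho> g)"
    using entries_in_fg_subring assms(1) unfolding finitely_generated_group_def by metis
  note A' = unital_subring_fg[OF A(1)]
  obtain i j where ij: "i < k" "j < k" "\<rho> x $$ (i,j) \<noteq> 1\<^sub>m k $$ (i,j)"
    using neq carr[OF x] by (metis carrier_matD eq_matI one_carrier_mat)
  define a where "a = (\<rho> x - 1\<^sub>m k) $$ (i, j)"
  have a0: "a \<noteq> 0" unfolding a_def using ij carr[OF x] by simp
  have "\<rho> x $$ (i,j) \<in> A" "1\<^sub>m k $$ (i,j) \<in> A"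
    using A(2)[OF x] entries_in_one[OF A', of k] ij carr[OF x] by (auto simp: entries_in_def)
  then have "a \<in> A" unfolding a_def using ij carr[OF x] by (auto intro: unital_subringD[OF A'])
  from unit_in_finite_quotient_fg[OF A(1) this a0] obtain I h where
    I: "ideal_of A I" "finite_index A I" "1 \<notin> I" and h: "h \<in> A" "a * h - 1 \<in> I"
    unfolding unit_in_finite_quotient_def by blast
  define N where "N = {g \<in> carrier G. entries_in I (\<rho> g - 1\<^sub>m k)}"
  have N: "N \<lhd> G" "finite (carrier (G Mod N))"
    unfolding N_def by (rule congruence_subgroup[OF A' I(1,2) A(2)], assumption)+
  then have "N #> x = N" using assms(2) unfolding ker_RF_def by auto
  then have "x \<in> N" using rcos_self[OF x] normal_imp_subgroup[OF N(1)] by auto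
  then have "a \<in> I" using ij carr[OF x] unfolding N_def a_def entries_in_def by auto
  then have "a * h \<in> I" using h(1) by (rule ideal_ofD(5)[OF I(1)])
  from ideal_of_diff[OF A' I(1) this h(2)] I(3) show False by simp
qed

end

section \<open>Operator norm and Hilbert-Schmidt norm\<close>

lemma mat_adjoint_dim [simp]:
  "dim_row (mat_adjoint A) = dim_col A" "dim_col (mat_adjoint A) = dim_row A"
  unfolding mat_adjoint_def by auto

lemma mat_adjoint_carrier [simp]: "A \<in> carrier_mat n m \<Longrightarrow> mat_adjoint A \<in> carrier_mat m n"
  unfolding mat_adjoint_def by auto

lemma mat_adjoint_index [simp]:
  fixes A :: "complex mat"
  shows "i < dim_col A \<Longrightarrow> j < dim_row A \<Longrightarrow> mat_adjoint A $$ (i, j) = cnj (A $$ (j, i))"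
  unfolding mat_adjoint_def by (simp add: mat_of_rows_def conjugate_complex_def)

lemma mult_mat_vec_sum:
  "A \<in> carrier_mat n m \<Longrightarrow> v \<in> carrier_vec m \<Longrightarrow> i < n \<Longrightarrow>
     (A *\<^sub>v v) $ i = (\<Sum>l<m. A $$ (i, l) * v $ l)"
  by (auto simp: scalar_prod_def lessThan_atLeast0 intro!: sum.cong)

lemma mat_adjoint_mult:
  fixes A :: "complex mat"
  assumes "A \<in> carrier_mat n m" "B \<in> carrier_mat m k"
  shows "mat_adjoint (A * B) = mat_adjoint B * mat_adjoint A"
  using assms
  by (intro eq_matI)
    (auto simp: mult_mat_sum[of _ n m _ k] mult_mat_sum[of _ k m _ n] mult.commute
      simp del: index_mult_mat(1) intro!: sum.cong)

lemma mat_adjoint_adjoint [simp]: "mat_adjoint (mat_adjoint A) = (A :: complex mat)"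
  by (intro eq_matI) auto

lemma mat_adjoint_one [simp]: "mat_adjoint (1\<^sub>m n :: complex mat) = 1\<^sub>m n"
  by (intro eq_matI) auto

lemma Re_mult_cnj: "Re (z * cnj z) = (cmod z)\<^sup>2"
  by (metis Re_complex_of_real complex_norm_square)

lemma Re_cscalar_self: "Re (v \<bullet>c v) = (\<Sum>i<dim_vec v. (cmod (v $ i))\<^sup>2)"
proof -
  have "v \<bullet>c v = (\<Sum>i<dim_vec v. v $ i * cnj (v $ i))"
    by (auto simp: scalar_prod_def lessThan_atLeast0 conjugate_complex_def intro!: sum.cong)
  then show ?thesis by (simp only: Re_sum Re_mult_cnj)
qed

lemma l2_norm_L2_set: "l2_norm v = L2_set (\<lambda>i. cmod (v $ i)) {..<dim_vec v}"
  unfolding l2_norm_def L2_set_def Re_cscalar_self ..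

lemma l2_norm_nonneg [simp]: "0 \<le> l2_norm v"
  unfolding l2_norm_L2_set by (rule L2_set_nonneg)

lemma l2_norm_power2: "(l2_norm v)\<^sup>2 = Re (v \<bullet>c v)"
  unfolding l2_norm_def Re_cscalar_self by (simp add: sum_nonneg)

lemma l2_norm_zero [simp]: "l2_norm (0\<^sub>v n) = 0"
  unfolding l2_norm_L2_set by (simp add: L2_set_def)

lemma l2_norm_eq_0: "v \<in> carrier_vec n \<Longrightarrow> l2_norm v = 0 \<Longrightarrow> v = 0\<^sub>v n"
  unfolding l2_norm_L2_set by (auto simp: L2_set_eq_0_iff)

lemma l2_norm_smult [simp]: "l2_norm (c \<cdot>\<^sub>v v) = cmod c * l2_norm v"
proof -
  have "l2_norm (c \<cdot>\<^sub>v v) = L2_set (\<lambda>i. cmod c * cmod (v $ i)) {..<dim_vec v}"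
    unfolding l2_norm_L2_set by (auto simp: L2_set_def norm_mult intro!: sum.cong)
  then show ?thesis unfolding l2_norm_L2_set by (simp add: L2_set_right_distrib)
qed

lemma l2_norm_unit_vec:
  assumes "i < n"
  shows "l2_norm (unit_vec n i) = 1"
proof -
  have "(\<Sum>j<n. (cmod (unit_vec n i $ j))\<^sup>2) = (\<Sum>j<n. if j = i then 1 else 0)"
    using assms by (intro sum.cong) auto
  also have "\<dots> = 1" using assms by simp
  finally show ?thesis unfolding l2_norm_def Re_cscalar_self by simp
qed

lemma l2_norm_triangle:
  assumes "v \<in> carrier_vec n" "w \<in> carrier_vec n"
  shows "l2_norm (v + w) \<le> l2_norm v + l2_norm w"
proof -
  have "l2_norm (v + w) \<le> L2_set (\<lambda>i. cmod (v $ i) + cmod (w $ i)) {..<n}"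
    unfolding l2_norm_L2_set using assms by (auto intro!: L2_set_mono norm_triangle_ineq)
  also have "\<dots> \<le> L2_set (\<lambda>i. cmod (v $ i)) {..<n} + L2_set (\<lambda>i. cmod (w $ i)) {..<n}"
    by (rule L2_set_triangle_ineq)
  finally show ?thesis unfolding l2_norm_L2_set using assms by simp
qed

lemma cscalar_Cauchy_Schwarz:
  assumes "v \<in> carrier_vec n" "w \<in> carrier_vec n"
  shows "cmod (v \<bullet>c w) \<le> l2_norm v * l2_norm w"
proof -
  have "cmod (v \<bullet>c w) \<le> (\<Sum>i<n. cmod (v $ i * cnj (w $ i)))"
    using assms by (auto simp: scalar_prod_def lessThan_atLeast0 conjugate_complex_def intro!: norm_sum)
  also have "\<dots> = (\<Sum>i<n. \<bar>cmod (v $ i)\<bar> * \<bar>cmod (w $ i)\<bar>)"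
    by (simp add: norm_mult)
  also have "\<dots> \<le> l2_norm v * l2_norm w"
    unfolding l2_norm_L2_set using assms L2_set_mult_ineq[of "\<lambda>i. cmod (v $ i)" "\<lambda>i. cmod (w $ i)" "{..<n}"] by simp
  finally show ?thesis .
qed

lemma cscalar_adjoint:
  fixes A :: "complex mat"
  assumes "A \<in> carrier_mat n m" "v \<in> carrier_vec m" "w \<in> carrier_vec n"
  shows "(A *\<^sub>v v) \<bullet>c w = v \<bullet>c (mat_adjoint A *\<^sub>v w)"
proof -
  have "(A *\<^sub>v v) \<bullet>c w = (\<Sum>i<n. (\<Sum>j<m. A $$ (i, j) * v $ j) * cnj (w $ i))"
    using assms mult_mat_vec_sum[OF assms(1,2)]
    by (auto simp: scalar_prod_def lessThan_atLeast0 conjugate_complex_def)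
  also have "\<dots> = (\<Sum>j<m. v $ j * (\<Sum>i<n. A $$ (i, j) * cnj (w $ i)))"
    unfolding sum_distrib_right sum_distrib_left
    by (subst sum.swap) (auto simp: algebra_simps intro!: sum.cong)
  also have "\<dots> = (\<Sum>j<m. v $ j * cnj ((mat_adjoint A *\<^sub>v w) $ j))"
    using assms by (intro sum.cong refl) (simp add: mult_mat_vec_sum[of _ m n] del: index_mult_mat_vec)
  also have "\<dots> = v \<bullet>c (mat_adjoint A *\<^sub>v w)"
    using assms by (auto simp: scalar_prod_def lessThan_atLeast0 conjugate_complex_def)
  finally show ?thesis .
qed

lemma op_norm_bdd:
  assumes "A \<in> carrier_mat n m"
  shows "bdd_above ((\<lambda>v. l2_norm (A *\<^sub>v v)) ` {v \<in> carrier_vec (dim_col A). l2_norm v \<le> 1})"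
proof (rule bdd_aboveI2)
  fix v assume "v \<in> {v \<in> carrier_vec (dim_col A). l2_norm v \<le> 1}"
  then have v: "v \<in> carrier_vec m" "l2_norm v \<le> 1" using assms by auto
  have le1: "cmod (v $ l) \<le> 1" if "l < m" for l
    using member_le_L2_set[of "{..<m}" l "\<lambda>i. cmod (v $ i)"] v that unfolding l2_norm_L2_set by auto
  have "l2_norm (A *\<^sub>v v) \<le> (\<Sum>i<n. cmod ((A *\<^sub>v v) $ i))"
    unfolding l2_norm_L2_set using L2_set_le_sum_abs[of "\<lambda>i. cmod ((A *\<^sub>v v) $ i)" "{..<n}"] assms by simp
  also have "\<dots> \<le> (\<Sum>i<n. \<Sum>l<m. cmod (A $$ (i, l)))"
  proof (rule sum_mono)
    fix i assume "i \<in> {..<n}"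
    then have "cmod ((A *\<^sub>v v) $ i) \<le> (\<Sum>l<m. cmod (A $$ (i, l) * v $ l))"
      using mult_mat_vec_sum[OF assms v(1), of i] norm_sum by auto
    also have "\<dots> \<le> (\<Sum>l<m. cmod (A $$ (i, l)))"
      using le1 by (intro sum_mono) (auto simp: norm_mult intro: mult_left_le)
    finally show "cmod ((A *\<^sub>v v) $ i) \<le> (\<Sum>l<m. cmod (A $$ (i, l)))" .
  qed
  finally show "l2_norm (A *\<^sub>v v) \<le> (\<Sum>i<n. \<Sum>l<m. cmod (A $$ (i, l)))" .
qed

lemma op_norm_nonneg: "0 \<le> op_norm A"
proof -
  have "l2_norm (A *\<^sub>v 0\<^sub>v (dim_col A)) \<le> op_norm A" unfolding op_norm_def
    by (rule cSUP_upper[OF _ op_norm_bdd[OF carrier_mat_triv]]) auto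
  then show ?thesis using l2_norm_nonneg order_trans by blast
qed

lemma l2_norm_mult_mat_vec_le:
  assumes A: "A \<in> carrier_mat n m" and v: "v \<in> carrier_vec m"
  shows "l2_norm (A *\<^sub>v v) \<le> op_norm A * l2_norm v"
proof (cases "l2_norm v = 0")
  case True
  then have "A *\<^sub>v v = 0\<^sub>v n" using l2_norm_eq_0[OF v] A
    by (intro eq_vecI) (auto simp: scalar_prod_def)
  then show ?thesis using True by simp
next
  case False
  define c where "c = complex_of_real (1 / l2_norm v)"
  have c: "cmod c = 1 / l2_norm v" unfolding c_def by (simp add: norm_divide)
  have "l2_norm (A *\<^sub>v (c \<cdot>\<^sub>v v)) \<le> op_norm A" unfolding op_norm_def
    by (rule cSUP_upper[OF _ op_norm_bdd[OF A]]) (use A v False c in auto)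
  moreover have "A *\<^sub>v (c \<cdot>\<^sub>v v) = c \<cdot>\<^sub>v (A *\<^sub>v v)" by (rule mult_mat_vec[OF A v])
  ultimately have "l2_norm (A *\<^sub>v v) / l2_norm v \<le> op_norm A" using c by simp
  then show ?thesis using False l2_norm_nonneg[of v] by (simp add: divide_le_eq)
qed

lemma op_norm_le:
  assumes "A \<in> carrier_mat n m" "0 \<le> c"
    "\<And>v. v \<in> carrier_vec m \<Longrightarrow> l2_norm (A *\<^sub>v v) \<le> c * l2_norm v"
  shows "op_norm A \<le> c"
  unfolding op_norm_def
proof (rule cSUP_least)
  show "{v \<in> carrier_vec (dim_col A). l2_norm v \<le> 1} \<noteq> {}"
    using l2_norm_zero by (force intro: zero_carrier_vec)
  fix v assume "v \<in> {v \<in> carrier_vec (dim_col A). l2_norm v \<le> 1}"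
  then have v: "v \<in> carrier_vec m" "l2_norm v \<le> 1" using assms by auto
  show "l2_norm (A *\<^sub>v v) \<le> c" using assms(3)[OF v(1)] mult_left_le[OF v(2) assms(2)] by linarith
qed

lemma op_norm_add:
  assumes A: "A \<in> carrier_mat n m" and B: "B \<in> carrier_mat n m"
  shows "op_norm (A + B) \<le> op_norm A + op_norm B"
proof (rule op_norm_le[of _ n m])
  fix v :: "complex vec" assume v: "v \<in> carrier_vec m"
  have "l2_norm ((A + B) *\<^sub>v v) \<le> l2_norm (A *\<^sub>v v) + l2_norm (B *\<^sub>v v)"
    unfolding add_mult_distrib_mat_vec[OF A B v] by (intro l2_norm_triangle[of _ n] mult_mat_vec_carrier[OF A v] mult_mat_vec_carrier[OF B v])
  also have "\<dots> \<le> (op_norm A + op_norm B) * l2_norm v"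
    using l2_norm_mult_mat_vec_le[OF A v] l2_norm_mult_mat_vec_le[OF B v] by (simp add: algebra_simps)
  finally show "l2_norm ((A + B) *\<^sub>v v) \<le> (op_norm A + op_norm B) * l2_norm v" .
qed (use A B in \<open>auto simp: op_norm_nonneg\<close>)

lemma op_norm_mult:
  assumes A: "A \<in> carrier_mat n m" and B: "B \<in> carrier_mat m k"
  shows "op_norm (A * B) \<le> op_norm A * op_norm B"
proof (rule op_norm_le[of _ n k])
  fix v :: "complex vec" assume v: "v \<in> carrier_vec k"
  have "l2_norm ((A * B) *\<^sub>v v) \<le> op_norm A * l2_norm (B *\<^sub>v v)"
    unfolding assoc_mult_mat_vec[OF A B v] by (rule l2_norm_mult_mat_vec_le[OF A]) (use B v in auto)
  also have "\<dots> \<le> op_norm A * (op_norm B * l2_norm v)"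
    by (intro mult_left_mono l2_norm_mult_mat_vec_le[OF B v] op_norm_nonneg)
  finally show "l2_norm ((A * B) *\<^sub>v v) \<le> op_norm A * op_norm B * l2_norm v" by simp
qed (use A B in \<open>auto simp: op_norm_nonneg\<close>)

lemma op_norm_smult_le: "op_norm (c \<cdot>\<^sub>m A) \<le> cmod c * op_norm A"
proof (rule op_norm_le[of _ "dim_row A" "dim_col A"])
  fix v :: "complex vec" assume v: "v \<in> carrier_vec (dim_col A)"
  have "(c \<cdot>\<^sub>m A) *\<^sub>v v = c \<cdot>\<^sub>v (A *\<^sub>v v)" using v
    by (intro eq_vecI) (auto simp: scalar_prod_def sum_distrib_left mult.assoc)
  then show "l2_norm ((c \<cdot>\<^sub>m A) *\<^sub>v v) \<le> cmod c * op_norm A * l2_norm v"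
    using l2_norm_mult_mat_vec_le[OF carrier_mat_triv v] by (simp add: mult.assoc mult_left_mono)
qed (auto simp: op_norm_nonneg)

lemma op_norm_minus_commute:
  assumes "A \<in> carrier_mat n m" "B \<in> carrier_mat n m"
  shows "op_norm (A - B) = op_norm (B - A)"
proof -
  have "op_norm (C - D) \<le> op_norm (D - C)" if "C \<in> carrier_mat n m" "D \<in> carrier_mat n m" for C D
  proof -
    have "C - D = (-1) \<cdot>\<^sub>m (D - C)" using that by (intro eq_matI) auto
    then show ?thesis using op_norm_smult_le[of "-1" "D - C"] by simp
  qed
  from this[OF assms] this[OF assms(2,1)] show ?thesis by simp
qed

lemma op_norm_triangle:
  assumes "A \<in> carrier_mat n m" "B \<in> carrier_mat n m" "C \<in> carrier_mat n m"
  shows "op_norm (A - C) \<le> op_norm (A - B) + op_norm (B - C)"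
proof -
  have "A - C = (A - B) + (B - C)" using assms by (intro eq_matI) auto
  then show ?thesis using op_norm_add[of "A - B" n m "B - C"] assms minus_carrier_mat by metis
qed

lemma op_norm_mult_contraction_left:
  assumes "A \<in> carrier_mat n m" "B \<in> carrier_mat m k" "op_norm A \<le> 1" "op_norm B \<le> c" "0 \<le> c"
  shows "op_norm (A * B) \<le> c"
  using op_norm_mult[OF assms(1,2)] mult_mono[OF assms(3,4) _ op_norm_nonneg] by simp

lemma op_norm_mult_contraction_right:
  assumes "A \<in> carrier_mat n m" "B \<in> carrier_mat m k" "op_norm A \<le> c" "op_norm B \<le> 1"
  shows "op_norm (A * B) \<le> c"
  using op_norm_mult[OF assms(1,2)] mult_mono[OF assms(3,4) _ op_norm_nonneg] order_trans[OF op_norm_nonneg assms(3)]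
  by simp

text \<open>Cauchy-Schwarz applied to \<open>\<parallel>A\<^sup>* v\<parallel>\<^sup>2 = \<langle>A A\<^sup>* v, v\<rangle>\<close>.\<close>

lemma op_norm_adjoint_le:
  assumes A: "A \<in> carrier_mat n m"
  shows "op_norm (mat_adjoint A) \<le> op_norm A"
proof (rule op_norm_le[of _ m n])
  fix v :: "complex vec" assume v: "v \<in> carrier_vec n"
  let ?w = "mat_adjoint A *\<^sub>v v"
  have A': "mat_adjoint A \<in> carrier_mat m n" using A by simp
  have w: "?w \<in> carrier_vec m" using A' v by auto
  have "(l2_norm ?w)\<^sup>2 = Re ((A *\<^sub>v ?w) \<bullet>c v)"
    unfolding l2_norm_power2 cscalar_adjoint[OF A w v] ..
  also have "\<dots> \<le> cmod ((A *\<^sub>v ?w) \<bullet>c v)" by (rule complex_Re_le_cmod)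
  also have "\<dots> \<le> l2_norm (A *\<^sub>v ?w) * l2_norm v"
    by (rule cscalar_Cauchy_Schwarz[of _ n]) (use A w v in auto)
  also have "\<dots> \<le> op_norm A * l2_norm ?w * l2_norm v"
    by (intro mult_right_mono l2_norm_mult_mat_vec_le[OF A w]) auto
  finally have *: "l2_norm ?w * l2_norm ?w \<le> l2_norm ?w * (op_norm A * l2_norm v)"
    by (simp add: power2_eq_square algebra_simps)
  show "l2_norm ?w \<le> op_norm A * l2_norm v"
  proof (cases "l2_norm ?w = 0")
    case True then show ?thesis by (simp add: op_norm_nonneg)
  next
    case False
    then show ?thesis using * l2_norm_nonneg[of ?w] by (metis less_le mult_le_cancel_left_pos)
  qed
qed (use A in \<open>auto simp: op_norm_nonneg\<close>)

lemma isometry_preserves_l2_norm: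
  assumes V: "V \<in> carrier_mat n k" "mat_adjoint V * V = 1\<^sub>m k" and v: "v \<in> carrier_vec k"
  shows "l2_norm (V *\<^sub>v v) = l2_norm v"
proof -
  have "(V *\<^sub>v v) \<bullet>c (V *\<^sub>v v) = v \<bullet>c (mat_adjoint V *\<^sub>v (V *\<^sub>v v))"
    by (rule cscalar_adjoint[OF V(1) v mult_mat_vec_carrier[OF V(1) v]])
  also have "mat_adjoint V *\<^sub>v (V *\<^sub>v v) = (mat_adjoint V * V) *\<^sub>v v"
    by (rule assoc_mult_mat_vec[symmetric, OF mat_adjoint_carrier[OF V(1)] V(1) v])
  finally show ?thesis unfolding l2_norm_def using V(2) v by simp
qed

lemma op_norm_isometry:
  assumes V: "V \<in> carrier_mat n k" "mat_adjoint V * V = 1\<^sub>m k"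
  shows "op_norm V \<le> 1" "op_norm (mat_adjoint V) \<le> 1"
proof -
  show "op_norm V \<le> 1" by (rule op_norm_le[OF V(1)]) (auto simp: isometry_preserves_l2_norm[OF V])
  then show "op_norm (mat_adjoint V) \<le> 1" using op_norm_adjoint_le[OF V(1)] by simp
qed

lemma cmod_entry_le_op_norm:
  assumes A: "A \<in> carrier_mat n m" and ij: "i < n" "j < m"
  shows "cmod (A $$ (i, j)) \<le> op_norm A"
proof -
  have "cmod (A $$ (i, j)) = cmod ((A *\<^sub>v unit_vec m j) $ i)" using A ij by simp
  also have "\<dots> \<le> l2_norm (A *\<^sub>v unit_vec m j)"
    unfolding l2_norm_L2_set using A ij member_le_L2_set[of "{..<n}" i "\<lambda>i. cmod ((A *\<^sub>v unit_vec m j) $ i)"] by simp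
  also have "\<dots> \<le> op_norm A" using l2_norm_mult_mat_vec_le[OF A, of "unit_vec m j"] l2_norm_unit_vec[OF ij(2)] by simp
  finally show ?thesis .
qed

lemma op_norm_mat_diag_le:
  assumes "0 \<le> c" "\<And>i. i < n \<Longrightarrow> cmod (d i) \<le> c"
  shows "op_norm (mat_diag n d) \<le> c"
proof (rule op_norm_le[of _ n n])
  fix v :: "complex vec" assume v: "v \<in> carrier_vec n"
  have e: "(mat_diag n d *\<^sub>v v) $ i = d i * v $ i" if "i < n" for i
    using that v by (subst mult_mat_vec_sum[of _ n n]) (auto simp: mat_diag_def if_distrib[of "\<lambda>x. x * _"] cong: if_cong)
  have "l2_norm (mat_diag n d *\<^sub>v v) = L2_set (\<lambda>i. cmod (d i * v $ i)) {..<n}"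
    unfolding l2_norm_L2_set using e by (auto simp: mat_diag_def intro!: L2_set_cong simp del: index_mult_mat_vec)
  also have "\<dots> \<le> L2_set (\<lambda>i. c * cmod (v $ i)) {..<n}"
    using assms by (intro L2_set_mono) (auto simp: norm_mult intro: mult_right_mono)
  also have "\<dots> = c * l2_norm v" using v assms(1) by (simp add: l2_norm_L2_set L2_set_right_distrib)
  finally show "l2_norm (mat_diag n d *\<^sub>v v) \<le> c * l2_norm v" .
qed (use assms in auto)

text \<open>The squared norm \<open>Tr(A\<^sup>*A)/k\<close> is the average of the squared lengths of the images of the basis
  vectors.\<close>

lemma HS_norm_ge:
  assumes A: "A \<in> carrier_mat k k" and "k > 0" "0 \<le> c"
    and lower: "\<And>v. v \<in> carrier_vec k \<Longrightarrow> c * l2_norm v \<le> l2_norm (A *\<^sub>v v)"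
  shows "c \<le> HS_norm A"
proof -
  have diag: "Re ((mat_adjoint A * A) $$ (i, i)) \<ge> c\<^sup>2" if i: "i < k" for i
  proof -
    have "(mat_adjoint A * A) $$ (i, i) = (\<Sum>l<k. cnj (A $$ (l, i)) * A $$ (l, i))"
      using A i by (simp add: mult_mat_sum[of _ k k] del: index_mult_mat(1))
    then have "Re ((mat_adjoint A * A) $$ (i, i)) = (\<Sum>l<k. (cmod (A $$ (l, i)))\<^sup>2)"
      by (simp only: Re_sum Re_mult_cnj mult.commute[of "cnj _"])
    also have "\<dots> = (l2_norm (A *\<^sub>v unit_vec k i))\<^sup>2"
      unfolding l2_norm_power2 Re_cscalar_self using A i by simp
    finally have e: "Re ((mat_adjoint A * A) $$ (i, i)) = (l2_norm (A *\<^sub>v unit_vec k i))\<^sup>2" .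
    have "c \<le> l2_norm (A *\<^sub>v unit_vec k i)"
      using lower[of "unit_vec k i"] l2_norm_unit_vec[OF i] by simp
    then show ?thesis unfolding e using assms(3) by (intro power_mono)
  qed
  have "real k * c\<^sup>2 = (\<Sum>i<k. c\<^sup>2)" by simp
  also have "\<dots> \<le> (\<Sum>i<k. Re ((mat_adjoint A * A) $$ (i, i)))"
    by (intro sum_mono diag) simp
  also have "\<dots> = Re (mat_trace (mat_adjoint A * A))"
    unfolding mat_trace_def Re_sum using A by simp
  finally have "sqrt (real k * c\<^sup>2) \<le> sqrt (Re (mat_trace (mat_adjoint A * A)))" by simp
  then have "sqrt (real k) * c \<le> sqrt (Re (mat_trace (mat_adjoint A * A)))"
    using assms(3) by (simp add: real_sqrt_mult)
  then show ?thesis unfolding HS_norm_def using A assms(2) by (simp add: field_simps)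
qed

section \<open>The spectral theorem for Hermitian matrices\<close>

lemma mult_assoc_conj:
  fixes A :: "'a::semiring_1 mat"
  assumes "A \<in> carrier_mat n n" "P \<in> carrier_mat n n" "Q \<in> carrier_mat n n"
  shows "(P * Q) * A * (P * Q) = P * (Q * A * P) * Q"
  using assms by (simp add: assoc_mult_mat[of _ n n _ n _ n] mult_carrier_mat[of _ n n])

lemma mult_assoc_conj2:
  fixes A :: "'a::semiring_1 mat"
  assumes "A \<in> carrier_mat n n" "P \<in> carrier_mat n n" "Q \<in> carrier_mat n n"
    "P' \<in> carrier_mat n n" "Q' \<in> carrier_mat n n"
  shows "P * (Q * A * Q') * P' = (P * Q) * A * (Q' * P')"
  using assms by (simp add: assoc_mult_mat[of _ n n _ n _ n] mult_carrier_mat[of _ n n])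

lemma mult_assoc4:
  fixes A :: "'a::semiring_1 mat"
  assumes "A \<in> carrier_mat n n" "B \<in> carrier_mat n n" "C \<in> carrier_mat n n" "D \<in> carrier_mat n n"
  shows "(A * B) * (C * D) = A * (B * C) * D"
  using assms by (simp add: assoc_mult_mat[of _ n n _ n _ n] mult_carrier_mat[of _ n n])

lemma unitary_group_iff:
  "U \<in> carrier (unitary_group n) \<longleftrightarrow>
     U \<in> carrier_mat n n \<and> mat_adjoint U * U = 1\<^sub>m n \<and> U * mat_adjoint U = 1\<^sub>m n"
  unfolding unitary_group_def by simp

lemma unitary_groupI:
  assumes "U \<in> carrier_mat n n" "mat_adjoint U * U = 1\<^sub>m n"
  shows "U \<in> carrier (unitary_group n)"
  unfolding unitary_group_iff
  using assms mat_mult_left_right_inverse[of "mat_adjoint U" n U] by simp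

lemma unitary_group_mult:
  assumes "U \<in> carrier (unitary_group n)" "V \<in> carrier (unitary_group n)"
  shows "U * V \<in> carrier (unitary_group n)"
proof (rule unitary_groupI)
  note U = assms[unfolded unitary_group_iff]
  show "U * V \<in> carrier_mat n n" using U mult_carrier_mat by blast
  have "mat_adjoint (U * V) * (U * V) = mat_adjoint V * (mat_adjoint U * (U * V))"
    using U by (simp add: mat_adjoint_mult[of U n n V n] assoc_mult_mat[of _ n n _ n _ n] mult_carrier_mat[of _ n n])
  also have "mat_adjoint U * (U * V) = (mat_adjoint U * U) * V"
    using U by (intro assoc_mult_mat[symmetric, of _ n n _ n _ n]) auto
  finally show "mat_adjoint (U * V) * (U * V) = 1\<^sub>m n" using U by (simp add: left_mult_one_mat[of V n n])
qed

lemma unitary_group_adjoint: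
  "U \<in> carrier (unitary_group n) \<Longrightarrow> mat_adjoint U \<in> carrier (unitary_group n)"
  unfolding unitary_group_iff by simp

text \<open>Complete \<open>v\<close> to a basis, orthogonalize by Gram-Schmidt (which keeps the first vector) and
  normalize.\<close>

lemma unitary_with_first_col:
  assumes v: "v \<in> carrier_vec n" and norm: "l2_norm v = 1" and n: "n > 0"
  shows "\<exists>W \<in> carrier (unitary_group n). col W 0 = v"
proof -
  interpret cof_vec_space n "TYPE(complex)" .
  have v0: "v \<noteq> 0\<^sub>v n" using norm by auto
  define b where "b = basis_completion v"
  note bc = basis_completion[OF v v0, folded b_def]
  have b: "set b \<subseteq> carrier_vec n" "distinct b" "\<not> lin_dep (set b)" "hd b = v" "length b = n"
    using bc by auto
  then obtain vs where bv: "b = v # vs" using n by (cases b) auto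
  define ws where "ws = gram_schmidt n b"
  note gs = gram_schmidt_result[OF b(1-3) refl, folded ws_def]
  have ws: "set ws \<subseteq> carrier_vec n" "corthogonal ws" "length ws = n" using gs b by auto
  have hd: "hd ws = v" unfolding ws_def bv by (rule gram_schmidt_hd[OF v])
  have orth: "(ws ! i \<bullet>c ws ! j = 0) = (i \<noteq> j)" if "i < n" "j < n" for i j
    using corthogonalD[OF ws(2)] ws that by auto
  have wc: "ws ! j \<in> carrier_vec n" if "j < n" for j using ws that by auto
  define c where "c j = complex_of_real (1 / l2_norm (ws ! j))" for j
  define W where "W = mat n n (\<lambda>(i, j). c j * (ws ! j) $ i)"
  have Wc: "W \<in> carrier_mat n n" unfolding W_def by simp
  have "mat_adjoint W * W = 1\<^sub>m n"
  proof (rule eq_matI)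
    fix i j assume ij: "i < dim_row (1\<^sub>m n :: complex mat)" "j < dim_col (1\<^sub>m n :: complex mat)"
    then have ij: "i < n" "j < n" by auto
    have "(mat_adjoint W * W) $$ (i, j) = (\<Sum>l<n. cnj (c i * (ws ! i) $ l) * (c j * (ws ! j) $ l))"
      using ij Wc unfolding mult_mat_sum[OF mat_adjoint_carrier[OF Wc] Wc ij] by (simp add: W_def)
    also have "\<dots> = c i * c j * (\<Sum>l<n. (ws ! j) $ l * cnj ((ws ! i) $ l))"
      unfolding sum_distrib_left by (rule sum.cong) (auto simp: c_def)
    also have "(\<Sum>l<n. (ws ! j) $ l * cnj ((ws ! i) $ l)) = ws ! j \<bullet>c ws ! i"
      using wc[OF ij(1)] by (auto simp: scalar_prod_def lessThan_atLeast0 conjugate_complex_def intro!: sum.cong)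
    finally have e: "(mat_adjoint W * W) $$ (i, j) = c i * c j * (ws ! j \<bullet>c ws ! i)" .
    show "(mat_adjoint W * W) $$ (i, j) = 1\<^sub>m n $$ (i, j)"
    proof (cases "i = j")
      case False
      then show ?thesis unfolding e using orth ij by simp
    next
      case True
      let ?w = "ws ! i"
      have self: "?w \<bullet>c ?w = complex_of_real ((l2_norm ?w)\<^sup>2)"
        using ij wc[OF ij(1)] unfolding l2_norm_power2 Re_cscalar_self
        by (auto simp: scalar_prod_def lessThan_atLeast0 conjugate_complex_def complex_norm_square simp flip: of_real_power intro!: sum.cong)
      then have "l2_norm ?w \<noteq> 0" using orth[OF ij(1) ij(1)] by auto
      then have "c i * c i * complex_of_real ((l2_norm ?w)\<^sup>2) = 1" unfolding c_def
        by (simp add: power2_eq_square flip: of_real_mult)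
      moreover have "(mat_adjoint W * W) $$ (i, j) = c i * c i * complex_of_real ((l2_norm ?w)\<^sup>2)"
        unfolding e by (simp only: True[symmetric] self)
      ultimately show ?thesis using True ij by (simp del: index_mult_mat(1))
    qed
  qed (use Wc in auto)
  then have "W \<in> carrier (unitary_group n)" by (rule unitary_groupI[OF Wc])
  moreover have "col W 0 = v"
  proof -
    have "ws ! 0 = v" using hd ws(3) n by (cases ws) auto
    then show ?thesis using n v norm unfolding W_def c_def by (intro eq_vecI) auto
  qed
  ultimately show ?thesis by blast
qed

text \<open>An eigenvector is made the first basis vector; Hermitian symmetry then clears the first row along
  with the first column and forces the eigenvalue to be real.\<close>

lemma hermitian_block_form:
  assumes A: "A \<in> carrier_mat (Suc m) (Suc m)" "mat_adjoint A = A"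
  shows "\<exists>W e C. W \<in> carrier (unitary_group (Suc m)) \<and> C \<in> carrier_mat m m \<and> mat_adjoint C = C \<and>
    mat_adjoint W * A * W = four_block_mat (mat 1 1 (\<lambda>_. complex_of_real e)) (0\<^sub>m 1 m) (0\<^sub>m m 1) C"
proof -
  let ?n = "Suc m"
  obtain e where "eigenvalue A e" using spectrum_non_empty[OF A(1)] unfolding spectrum_def by auto
  then obtain v0 where v0: "v0 \<in> carrier_vec ?n" "v0 \<noteq> 0\<^sub>v ?n" "A *\<^sub>v v0 = e \<cdot>\<^sub>v v0"
    using A unfolding eigenvalue_def eigenvector_def by auto
  define v where "v = complex_of_real (1 / l2_norm v0) \<cdot>\<^sub>v v0"
  have n0: "l2_norm v0 \<noteq> 0" using l2_norm_eq_0 v0 by blast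
  then have vn: "l2_norm v = 1" unfolding v_def by (simp add: norm_divide)
  have v: "v \<in> carrier_vec ?n" using v0 unfolding v_def by simp
  have ev: "A *\<^sub>v v = e \<cdot>\<^sub>v v" unfolding v_def using v0 A
    by (simp add: mult_mat_vec[OF A(1) v0(1)] smult_smult_assoc mult.commute)
  obtain W where W: "W \<in> carrier (unitary_group ?n)" "col W 0 = v"
    using unitary_with_first_col[OF v vn] by auto
  note W' = W(1)[unfolded unitary_group_iff]
  define B where "B = mat_adjoint W * A * W"
  have Bc: "B \<in> carrier_mat ?n ?n" unfolding B_def using A W' by auto
  have Bh: "mat_adjoint B = B" unfolding B_def using A W'
    by (simp add: mat_adjoint_mult[of _ ?n ?n _ ?n] assoc_mult_mat[of _ ?n ?n _ ?n _ ?n] mult_carrier_mat[of _ ?n ?n])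
  have sym: "cnj (B $$ (j, i)) = B $$ (i, j)" if "i < ?n" "j < ?n" for i j
    using mat_adjoint_index[of i B j] Bh Bc that by simp
  have "col B 0 = mat_adjoint W *\<^sub>v (A *\<^sub>v col W 0)"
  proof -
    have "col B 0 = (mat_adjoint W * A) *\<^sub>v col W 0"
      unfolding B_def using A W' by (intro col_mult2[of _ ?n ?n _ ?n]) auto
    also have "\<dots> = mat_adjoint W *\<^sub>v (A *\<^sub>v col W 0)"
      using A W' W(2) v by (intro assoc_mult_mat_vec[of _ ?n ?n _ ?n]) auto
    finally show ?thesis .
  qed
  also have "\<dots> = e \<cdot>\<^sub>v (mat_adjoint W *\<^sub>v col W 0)"
    unfolding W(2) ev by (rule mult_mat_vec[of _ ?n ?n]) (use W' v in auto)
  also have "mat_adjoint W *\<^sub>v col W 0 = col (mat_adjoint W * W) 0"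
    using W' by (intro col_mult2[symmetric, of _ ?n ?n _ ?n]) auto
  finally have colB: "col B 0 = e \<cdot>\<^sub>v unit_vec ?n 0" using W' by simp
  have B0: "B $$ (i, 0) = (if i = 0 then e else 0)" if "i < ?n" for i
  proof -
    have "B $$ (i, 0) = col B 0 $ i" using that Bc by simp
    then show ?thesis unfolding colB using that by simp
  qed
  have e: "e = complex_of_real (Re e)" using sym[of 0 0] B0[of 0] by (simp add: complex_eq_iff)
  define C where "C = mat m m (\<lambda>(i, j). B $$ (Suc i, Suc j))"
  have "mat_adjoint C = C" by (rule eq_matI) (auto simp: C_def sym)
  moreover have "B = four_block_mat (mat 1 1 (\<lambda>_. complex_of_real (Re e))) (0\<^sub>m 1 m) (0\<^sub>m m 1) C"
  proof (rule eq_matI)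
    fix i j assume "i < dim_row (four_block_mat (mat 1 1 (\<lambda>_. complex_of_real (Re e))) (0\<^sub>m 1 m) (0\<^sub>m m 1) C)"
      "j < dim_col (four_block_mat (mat 1 1 (\<lambda>_. complex_of_real (Re e))) (0\<^sub>m 1 m) (0\<^sub>m m 1) C)"
    then have ij: "i < ?n" "j < ?n" by (auto simp: C_def)
    show "B $$ (i, j) = four_block_mat (mat 1 1 (\<lambda>_. complex_of_real (Re e))) (0\<^sub>m 1 m) (0\<^sub>m m 1) C $$ (i, j)"
    proof (cases i)
      case 0
      have "B $$ (0, j) = (if j = 0 then e else 0)"
        using sym[of 0 j] B0[of j] ij e by (metis complex_cnj_zero complex_cnj_complex_of_real zero_less_Suc)
      then show ?thesis using 0 ij e by (simp add: C_def)
    next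
      case (Suc i')
      then show ?thesis using ij B0[of i] by (simp add: C_def)
    qed
  qed (use Bc in \<open>auto simp: C_def\<close>)
  moreover have "C \<in> carrier_mat m m" by (simp add: C_def)
  ultimately show ?thesis using W(1) unfolding B_def by blast
qed

theorem hermitian_spectral:
  assumes "A \<in> carrier_mat n n" "mat_adjoint A = A"
  shows "\<exists>W d. W \<in> carrier (unitary_group n) \<and>
    A = W * mat_diag n (\<lambda>i. complex_of_real (d i)) * mat_adjoint W"
  using assms
proof (induction n arbitrary: A)
  case 0
  then show ?case by (intro exI[of _ "1\<^sub>m 0"] exI) (auto simp: unitary_group_iff)
next
  case (Suc m)
  let ?n = "Suc m"
  obtain W e C where W: "W \<in> carrier (unitary_group ?n)" and C: "C \<in> carrier_mat m m" "mat_adjoint C = C"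
    and B: "mat_adjoint W * A * W = four_block_mat (mat 1 1 (\<lambda>_. complex_of_real e)) (0\<^sub>m 1 m) (0\<^sub>m m 1) C"
    using hermitian_block_form[OF Suc.prems] by blast
  obtain Z d where Z: "Z \<in> carrier (unitary_group m)"
    and CZ: "C = Z * mat_diag m (\<lambda>i. complex_of_real (d i)) * mat_adjoint Z"
    using Suc.IH[OF C] by blast
  note W' = W[unfolded unitary_group_iff] and Z' = Z[unfolded unitary_group_iff]
  let ?D = "mat_diag m (\<lambda>i. complex_of_real (d i))" and ?E = "mat 1 1 (\<lambda>_. complex_of_real e)"
  define Y where "Y = four_block_mat (1\<^sub>m 1) (0\<^sub>m 1 m) (0\<^sub>m m 1) Z"
  define d' where "d' i = (case i of 0 \<Rightarrow> e | Suc i \<Rightarrow> d i)" for i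
  have Yc: "Y \<in> carrier_mat ?n ?n" unfolding Y_def using Z' by auto
  have Ya: "mat_adjoint Y = four_block_mat (1\<^sub>m 1) (0\<^sub>m 1 m) (0\<^sub>m m 1) (mat_adjoint Z)"
    using Z' Yc by (intro eq_matI) (auto simp: Y_def)
  have Yu: "Y \<in> carrier (unitary_group ?n)"
  proof (rule unitary_groupI[OF Yc])
    have "mat_adjoint Y * Y = four_block_mat (1\<^sub>m 1) (0\<^sub>m 1 m) (0\<^sub>m m 1) (1\<^sub>m m)"
      unfolding Ya unfolding Y_def using Z'
      by (subst mult_four_block_mat[of _ 1 1 _ m _ m _ _ 1 _ m]) (auto simp: left_mult_zero_mat[of _ m m] right_mult_zero_mat[of _ m m] left_add_zero_mat[of _ 1 m] left_add_zero_mat[of _ m 1] left_add_zero_mat[of _ m m] mult_carrier_mat[of _ m m])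
    also have "\<dots> = 1\<^sub>m ?n" by (intro eq_matI) auto
    finally show "mat_adjoint Y * Y = 1\<^sub>m ?n" .
  qed
  have D: "mat_diag ?n (\<lambda>i. complex_of_real (d' i)) = four_block_mat ?E (0\<^sub>m 1 m) (0\<^sub>m m 1) ?D"
    by (intro eq_matI) (auto simp: mat_diag_def d'_def split: nat.splits)
  have YDY: "Y * mat_diag ?n (\<lambda>i. complex_of_real (d' i)) * mat_adjoint Y = mat_adjoint W * A * W"
  proof -
    have "Y * mat_diag ?n (\<lambda>i. complex_of_real (d' i)) = four_block_mat ?E (0\<^sub>m 1 m) (0\<^sub>m m 1) (Z * ?D)"
      unfolding D unfolding Y_def using Z'
      by (subst mult_four_block_mat[of _ 1 1 _ m _ m _ _ 1 _ m]) (auto simp: left_mult_zero_mat[of _ m m] right_mult_zero_mat[of _ m m] left_add_zero_mat[of _ 1 m] left_add_zero_mat[of _ m 1] left_add_zero_mat[of _ m m] mult_carrier_mat[of _ m m])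
    note YD = this
    show ?thesis unfolding B CZ YD unfolding Ya using Z'
      by (subst mult_four_block_mat[of _ 1 1 _ m _ m _ _ 1 _ m]) (auto simp: left_mult_zero_mat[of _ m m] right_mult_zero_mat[of _ m m] left_add_zero_mat[of _ 1 m] left_add_zero_mat[of _ m 1] left_add_zero_mat[of _ m m] mult_carrier_mat[of _ m m])
  qed
  have Dc: "mat_diag ?n (\<lambda>i. complex_of_real (d' i)) \<in> carrier_mat ?n ?n" by simp
  have "A = (W * mat_adjoint W) * A * (W * mat_adjoint W)"
    using W' Suc.prems(1) by (auto simp: left_mult_one_mat[of _ ?n ?n] right_mult_one_mat[of _ ?n ?n])
  also have "\<dots> = W * (mat_adjoint W * A * W) * mat_adjoint W"
    using W' Suc.prems by (intro mult_assoc_conj) auto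
  also have "\<dots> = (W * Y) * mat_diag ?n (\<lambda>i. complex_of_real (d' i)) * mat_adjoint (W * Y)"
    unfolding YDY[symmetric] mat_adjoint_mult[OF conjunct1[OF W'] Yc]
    using W' Yc by (intro mult_assoc_conj2) auto
  finally show ?case using unitary_group_mult[OF W Yu] by blast
qed

text \<open>For unitary \<open>W\<close> and a Hermitian matrix \<open>H = W diag(d) W\<^sup>*\<close>, the value \<open>h(H)\<close> of a function under
  functional calculus is \<open>conj_diag n W (h \<circ> d)\<close>.\<close>

definition conj_diag :: "nat \<Rightarrow> complex mat \<Rightarrow> (nat \<Rightarrow> complex) \<Rightarrow> complex mat" where
  "conj_diag n W f = W * mat_diag n f * mat_adjoint W"

lemma conj_diag_carrier [simp]: "W \<in> carrier_mat n n \<Longrightarrow> conj_diag n W f \<in> carrier_mat n n"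
  unfolding conj_diag_def by (intro mult_carrier_mat[of _ n n]) simp_all

lemma conj_diag_dim [simp]:
  "dim_row (conj_diag n W f) = dim_row W" "dim_col (conj_diag n W f) = dim_row W"
  unfolding conj_diag_def by simp_all

lemma conj_diag_index:
  assumes W: "W \<in> carrier_mat n n" and "a < n" "b < n"
  shows "conj_diag n W f $$ (a, b) = (\<Sum>i<n. f i * (W $$ (a, i) * cnj (W $$ (b, i))))"
proof -
  have WD: "W * mat_diag n f = mat n n (\<lambda>(i, j). W $$ (i, j) * f j)"
    by (rule mat_diag_mult_right[OF W])
  have "conj_diag n W f $$ (a, b) = (\<Sum>i<n. (W * mat_diag n f) $$ (a, i) * mat_adjoint W $$ (i, b))"
    unfolding conj_diag_def using assms by (intro mult_mat_sum[of _ n n _ n]) (auto simp: WD)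
  also have "\<dots> = (\<Sum>i<n. f i * (W $$ (a, i) * cnj (W $$ (b, i))))"
    unfolding WD using assms by (intro sum.cong) auto
  finally show ?thesis .
qed

lemma conj_diag_diff:
  assumes "W \<in> carrier_mat n n"
  shows "conj_diag n W f - conj_diag n W g = conj_diag n W (\<lambda>i. f i - g i)"
proof (rule eq_matI)
  fix a b assume "a < dim_row (conj_diag n W (\<lambda>i. f i - g i))" "b < dim_col (conj_diag n W (\<lambda>i. f i - g i))"
  then have "a < n" "b < n" using assms by auto
  then show "(conj_diag n W f - conj_diag n W g) $$ (a, b) = conj_diag n W (\<lambda>i. f i - g i) $$ (a, b)"
    using assms by (simp add: conj_diag_index[OF assms] sum_subtractf left_diff_distrib)
qed auto

lemma conj_diag_adjoint:
  assumes "W \<in> carrier_mat n n"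
  shows "mat_adjoint (conj_diag n W f) = conj_diag n W (\<lambda>i. cnj (f i))"
proof (rule eq_matI)
  fix a b assume "a < dim_row (conj_diag n W (\<lambda>i. cnj (f i)))" "b < dim_col (conj_diag n W (\<lambda>i. cnj (f i)))"
  then have "a < n" "b < n" using assms by auto
  then show "mat_adjoint (conj_diag n W f) $$ (a, b) = conj_diag n W (\<lambda>i. cnj (f i)) $$ (a, b)"
    using assms by (simp add: conj_diag_index[OF assms] mult.commute[of "W $$ _"])
qed auto

lemma conj_diag_one:
  assumes "W \<in> carrier (unitary_group n)"
  shows "conj_diag n W (\<lambda>_. 1) = 1\<^sub>m n"
proof -
  note W = assms[unfolded unitary_group_iff]
  have "W * 1\<^sub>m n = W" using W by (intro right_mult_one_mat[of _ n n]) simp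
  then show ?thesis unfolding conj_diag_def mat_diag_one using W by simp
qed

lemma conj_diag_mult:
  assumes "W \<in> carrier (unitary_group n)"
  shows "conj_diag n W f * conj_diag n W g = conj_diag n W (\<lambda>i. f i * g i)"
proof -
  note W = assms[unfolded unitary_group_iff]
  let ?F = "mat_diag n f" and ?G = "mat_diag n g" and ?W = "mat_adjoint W"
  have c: "W * ?F \<in> carrier_mat n n" "?G * ?W \<in> carrier_mat n n"
    using W by (auto intro!: mult_carrier_mat[of _ n n])
  have "(W * ?F * ?W) * (W * ?G * ?W) = (W * ?F * ?W) * (W * (?G * ?W))"
    using W by (simp add: assoc_mult_mat[of W n n ?G n ?W n])
  also have "\<dots> = (W * ?F) * (?W * W) * (?G * ?W)"
    using W c by (intro mult_assoc4) auto
  also have "\<dots> = (W * ?F) * (?G * ?W)"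
    using W c by (simp add: right_mult_one_mat[of _ n n])
  also have "\<dots> = W * (?F * ?G) * ?W"
    using W by (intro mult_assoc4) auto
  finally show ?thesis unfolding conj_diag_def by simp
qed

lemma op_norm_unitary: "U \<in> carrier (unitary_group n) \<Longrightarrow> op_norm U \<le> 1"
  using op_norm_isometry(1)[of U n n] unfolding unitary_group_iff by simp

lemma op_norm_unitary_conj_le:
  assumes W: "W \<in> carrier (unitary_group n)" "Z \<in> carrier (unitary_group n)" and A: "A \<in> carrier_mat n n"
  shows "op_norm (W * A * Z) \<le> op_norm A"
proof -
  have Wc: "W \<in> carrier_mat n n" "Z \<in> carrier_mat n n" using W unitary_group_iff by blast+
  have "op_norm (W * A) \<le> op_norm A"
    by (rule op_norm_mult_contraction_left[OF Wc(1) A op_norm_unitary[OF W(1)] order_refl op_norm_nonneg])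
  then show ?thesis
    by (rule op_norm_mult_contraction_right[OF mult_carrier_mat[OF Wc(1) A] Wc(2) _ op_norm_unitary[OF W(2)]])
qed

lemma op_norm_conj_diag_le:
  assumes "W \<in> carrier (unitary_group n)" "0 \<le> c" "\<And>i. i < n \<Longrightarrow> cmod (f i) \<le> c"
  shows "op_norm (conj_diag n W f) \<le> c"
proof -
  have "op_norm (mat_diag n f) \<le> c" by (rule op_norm_mat_diag_le[OF assms(2,3)])
  then show ?thesis unfolding conj_diag_def
    using op_norm_unitary_conj_le[OF assms(1) unitary_group_adjoint[OF assms(1)] mat_diag_dim, of f] by linarith
qed

lemma cmod_coeff_le_op_norm_conj_diag:
  assumes "W \<in> carrier (unitary_group n)" "i < n"
  shows "cmod (f i) \<le> op_norm (conj_diag n W f)"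
proof -
  note W = assms(1)[unfolded unitary_group_iff]
  let ?W = "mat_adjoint W" and ?C = "conj_diag n W f"
  have Cc: "?C \<in> carrier_mat n n" using W by simp
  have "?W * ?C * W = (?W * W) * mat_diag n f * (?W * W)"
    unfolding conj_diag_def using W by (intro mult_assoc_conj2) auto
  also have "\<dots> = mat_diag n f" using W by (simp add: left_mult_one_mat[of _ n n] right_mult_one_mat[of _ n n])
  finally have e: "?W * ?C * W = mat_diag n f" .
  have "cmod (f i) = cmod (mat_diag n f $$ (i, i))" using assms(2) by (simp add: mat_diag_def)
  also have "\<dots> \<le> op_norm (mat_diag n f)" by (rule cmod_entry_le_op_norm[of _ n n]) (use assms in auto)
  also have "\<dots> \<le> op_norm ?C" unfolding e[symmetric]
    by (rule op_norm_unitary_conj_le[OF unitary_group_adjoint[OF assms(1)] assms(1) Cc])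
  finally show ?thesis .
qed

lemma one_unitary [simp]: "1\<^sub>m n \<in> carrier (unitary_group n)"
  unfolding unitary_group_iff by simp

section \<open>Almost unitary matrices and almost involutions\<close>

lemma op_norm_diff_le_2:
  assumes "A \<in> carrier_mat n m" "B \<in> carrier_mat n m" "op_norm A \<le> 1" "op_norm B \<le> 1"
  shows "op_norm (A - B) \<le> 2"
proof -
  have "A - B = A + (-1) \<cdot>\<^sub>m B" using assms by (intro eq_matI) auto
  then have "op_norm (A - B) \<le> op_norm A + op_norm ((-1) \<cdot>\<^sub>m B)"
    using op_norm_add[of A n m "(-1) \<cdot>\<^sub>m B"] assms by simp
  also have "\<dots> \<le> 1 + 1" using assms op_norm_smult_le[of "-1" B] by (intro add_mono) auto
  finally show ?thesis by simp
qed

text \<open>The nearby unitary is the unitary part \<open>Y (Y\<^sup>*Y)\<^sup>-\<^sup>1\<^sup>/\<^sup>2\<close> of the polar decomposition, defined when the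
  defect is less than \<open>1\<close>; the estimate is then \<open>\<bar>sqrt d - 1\<bar> \<le> \<bar>d - 1\<bar>\<close> on the spectrum of \<open>Y\<^sup>*Y\<close>.
  The factor \<open>2\<close> makes the statement hold without a smallness assumption: if the defect is at
  least \<open>1\<close>, the identity is near enough, as two contractions are at distance at most \<open>2\<close>.\<close>

lemma contraction_near_unitary:
  assumes Y: "Y \<in> carrier_mat k k" "op_norm Y \<le> 1"
  shows "\<exists>U \<in> carrier (unitary_group k). op_norm (Y - U) \<le> 2 * op_norm (mat_adjoint Y * Y - 1\<^sub>m k)"
proof -
  define H where "H = mat_adjoint Y * Y"
  define \<delta> where "\<delta> = op_norm (H - 1\<^sub>m k)"
  show ?thesis
  proof (cases "\<delta> < 1")
    case False
    have "op_norm (Y - 1\<^sub>m k) \<le> 2"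
      by (rule op_norm_diff_le_2[of _ k k]) (use Y op_norm_unitary[OF one_unitary] in auto)
    then show ?thesis using False unfolding H_def[symmetric] \<delta>_def[symmetric]
      by (intro bexI[of _ "1\<^sub>m k"]) auto
  next
    case True
    have Hc: "H \<in> carrier_mat k k" unfolding H_def using Y by (auto intro: mult_carrier_mat)
    have "mat_adjoint H = H" unfolding H_def using Y by (simp add: mat_adjoint_mult[of _ k k _ k])
    from hermitian_spectral[OF Hc this] obtain W d where W: "W \<in> carrier (unitary_group k)"
      and H: "H = conj_diag k W (\<lambda>i. complex_of_real (d i))" unfolding conj_diag_def by blast
    note W' = W[unfolded unitary_group_iff]
    have d: "\<bar>d i - 1\<bar> \<le> \<delta>" if "i < k" for i
    proof -
      have "H - 1\<^sub>m k = conj_diag k W (\<lambda>i. complex_of_real (d i) - 1)"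
        unfolding H conj_diag_one[OF W, symmetric] using W' by (simp add: conj_diag_diff)
      then have "cmod (complex_of_real (d i) - 1) \<le> \<delta>"
        unfolding \<delta>_def using cmod_coeff_le_op_norm_conj_diag[OF W that] by simp
      then show ?thesis by (metis norm_of_real of_real_1 of_real_diff)
    qed
    have pos: "d i > 0" if "i < k" for i using d[OF that] True by linarith
    have cong: "conj_diag k W f = conj_diag k W g" if "\<And>i. i < k \<Longrightarrow> f i = g i" for f g
      unfolding conj_diag_def mat_diag_def using that by (intro arg_cong2[where f = "(*)"] refl eq_matI) auto
    define S where "S = conj_diag k W (\<lambda>i. complex_of_real (1 / sqrt (d i)))"
    define R where "R = conj_diag k W (\<lambda>i. complex_of_real (sqrt (d i)))"
    have Sc: "S \<in> carrier_mat k k" "mat_adjoint S = S" and Rc: "R \<in> carrier_mat k k"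
      unfolding S_def R_def using W' by (auto simp: conj_diag_adjoint)
    have SR: "S * R = 1\<^sub>m k"
      unfolding S_def R_def conj_diag_mult[OF W] conj_diag_one[OF W, symmetric]
    proof (rule cong)
      fix i assume "i < k"
      then have "1 / sqrt (d i) * sqrt (d i) = 1" using pos[of i] by simp
      then show "complex_of_real (1 / sqrt (d i)) * complex_of_real (sqrt (d i)) = 1"
        by (metis of_real_1 of_real_mult)
    qed
    define U where "U = Y * S"
    have Uc: "U \<in> carrier_mat k k" unfolding U_def using Y Sc by (auto intro: mult_carrier_mat)
    have "mat_adjoint U * U = S * H * S"
      unfolding U_def H_def mat_adjoint_mult[OF Y(1) Sc(1)] Sc(2)
      using Y Sc by (intro mult_assoc4) auto
    also have "\<dots> = 1\<^sub>m k" unfolding S_def H conj_diag_mult[OF W] conj_diag_one[OF W, symmetric]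
    proof (rule cong)
      fix i assume "i < k"
      then have "1 / sqrt (d i) * d i * (1 / sqrt (d i)) = 1" using pos[of i]
        by (simp add: real_div_sqrt field_simps)
      then show "complex_of_real (1 / sqrt (d i)) * complex_of_real (d i) * complex_of_real (1 / sqrt (d i)) = 1"
        by (metis of_real_1 of_real_mult)
    qed
    finally have U: "U \<in> carrier (unitary_group k)" by (rule unitary_groupI[OF Uc])
    have "Y = Y * (S * R)" unfolding SR using Y by (simp add: right_mult_one_mat[of _ k k])
    also have "\<dots> = U * R" unfolding U_def using Y Sc Rc by (simp add: assoc_mult_mat[of _ k k _ k _ k])
    finally have "Y - U = U * (R - 1\<^sub>m k)"
      using Uc Rc by (simp add: mult_minus_distrib_mat[of _ k k _ k] right_mult_one_mat[of _ k k])
    moreover have "op_norm (R - 1\<^sub>m k) \<le> \<delta>"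
    proof -
      have "R - 1\<^sub>m k = conj_diag k W (\<lambda>i. complex_of_real (sqrt (d i)) - 1)"
        unfolding R_def conj_diag_one[OF W, symmetric] using W' by (simp add: conj_diag_diff)
      moreover have "cmod (complex_of_real (sqrt (d i)) - 1) \<le> \<delta>" if i: "i < k" for i
      proof -
        have "\<bar>sqrt (d i) - 1\<bar> * 1 \<le> \<bar>sqrt (d i) - 1\<bar> * \<bar>sqrt (d i) + 1\<bar>"
          using pos[OF i] by (intro mult_left_mono) auto
        also have "\<dots> = \<bar>(sqrt (d i))\<^sup>2 - 1\<bar>"
          by (simp add: abs_mult[symmetric] power2_eq_square algebra_simps)
        also have "\<dots> = \<bar>d i - 1\<bar>" using pos[OF i] by simp
        also have "\<dots> \<le> \<delta>" by (rule d[OF i])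
        finally show ?thesis by (metis mult_1_right norm_of_real of_real_1 of_real_diff)
      qed
      ultimately show ?thesis
        using op_norm_conj_diag_le[OF W, of \<delta>] op_norm_nonneg unfolding \<delta>_def by metis
    qed
    ultimately have "op_norm (Y - U) \<le> \<delta>"
      using op_norm_mult_contraction_left[of U k k "R - 1\<^sub>m k" k \<delta>] Uc op_norm_unitary[OF U]
        minus_carrier_mat[OF one_carrier_mat, of R k] op_norm_nonneg[of "H - 1\<^sub>m k"] unfolding \<delta>_def by simp
    then show ?thesis using U op_norm_nonneg[of "H - 1\<^sub>m k"] unfolding H_def[symmetric] \<delta>_def[symmetric]
      by (intro bexI[of _ U]) (auto simp: \<delta>_def)
  qed
qed

text \<open>Here \<open>\<bar>d\<^sup>2 - 1\<bar> = \<bar>d - s\<bar> \<bar>d + s\<bar>\<close> for either sign \<open>s\<close>, and \<open>\<bar>d + s\<bar> = \<bar>d\<bar> + 1\<close> for the sign of \<open>d\<close>.\<close>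

lemma dist_sign_le:
  fixes d :: real
  shows "\<bar>d - (if d < 0 then -1 else 1)\<bar> \<le> \<bar>d\<^sup>2 - 1\<bar>"
proof -
  let ?s = "if d < 0 then -1 else 1 :: real"
  have "\<bar>d - ?s\<bar> * 1 \<le> \<bar>d - ?s\<bar> * \<bar>d + ?s\<bar>" by (intro mult_left_mono) auto
  also have "\<dots> = \<bar>d\<^sup>2 - 1\<bar>" unfolding abs_mult[symmetric] by (auto simp: power2_eq_square algebra_simps)
  finally show ?thesis by simp
qed

text \<open>The columns of \<open>W\<close> selected by \<open>P\<close> form an isometry whose range projection is the spectral
  projection for \<open>P\<close>.\<close>

lemma eigencolumns_isometry:
  fixes P :: "nat \<Rightarrow> bool"
  assumes "W \<in> carrier (unitary_group n)"
  shows "\<exists>k V. V \<in> carrier_mat n k \<and> mat_adjoint V * V = 1\<^sub>m k \<and>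
    V * mat_adjoint V = conj_diag n W (\<lambda>i. if P i then 1 else 0)"
proof -
  note W = assms[unfolded unitary_group_iff]
  define idx where "idx = filter P [0..<n]"
  define k where "k = length idx"
  have dist: "distinct idx" unfolding idx_def by simp
  have idx_less: "idx ! j < n" if "j < k" for j using nth_mem[of j idx] that unfolding k_def idx_def by auto
  define V where "V = mat n k (\<lambda>(i, j). W $$ (i, idx ! j))"
  have Vc: "V \<in> carrier_mat n k" unfolding V_def by simp
  have "mat_adjoint V * V = 1\<^sub>m k"
  proof (rule eq_matI)
    fix i j assume "i < dim_row (1\<^sub>m k :: complex mat)" "j < dim_col (1\<^sub>m k :: complex mat)"
    then have ij: "i < k" "j < k" by auto
    have "(mat_adjoint V * V) $$ (i, j) = (\<Sum>l<n. mat_adjoint W $$ (idx ! i, l) * W $$ (l, idx ! j))"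
      unfolding mult_mat_sum[OF mat_adjoint_carrier[OF Vc] Vc ij] using ij Vc W idx_less
      by (intro sum.cong) (auto simp: V_def)
    also have "\<dots> = (mat_adjoint W * W) $$ (idx ! i, idx ! j)"
      using mult_mat_sum[of "mat_adjoint W" n n W n, OF _ _ idx_less idx_less] W ij by simp
    also have "\<dots> = 1\<^sub>m n $$ (idx ! i, idx ! j)" using W by simp
    also have "\<dots> = 1\<^sub>m k $$ (i, j)"
      using ij idx_less nth_eq_iff_index_eq[OF dist, folded k_def] by simp
    finally show "(mat_adjoint V * V) $$ (i, j) = 1\<^sub>m k $$ (i, j)" .
  qed (use Vc in auto)
  moreover have "V * mat_adjoint V = conj_diag n W (\<lambda>i. if P i then 1 else 0)"
  proof (rule eq_matI)
    fix a b assume "a < dim_row (conj_diag n W (\<lambda>i. if P i then 1 else 0))" "b < dim_col (conj_diag n W (\<lambda>i. if P i then 1 else 0))"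
    then have ab: "a < n" "b < n" using W by auto
    let ?g = "\<lambda>i. W $$ (a, i) * cnj (W $$ (b, i))"
    have "(V * mat_adjoint V) $$ (a, b) = (\<Sum>j<k. ?g (idx ! j))"
      unfolding mult_mat_sum[OF Vc mat_adjoint_carrier[OF Vc] ab] using ab Vc
      by (intro sum.cong) (auto simp: V_def)
    also have "\<dots> = sum_list (map ?g idx)" unfolding k_def by (simp add: sum_list_sum_nth lessThan_atLeast0)
    also have "\<dots> = sum ?g (set idx)" by (rule sum_list_distinct_conv_sum_set[OF dist])
    also have "set idx = {i \<in> {..<n}. P i}" unfolding idx_def by auto
    also have "sum ?g {i \<in> {..<n}. P i} = (\<Sum>i<n. (if P i then 1 else 0) * ?g i)"
      unfolding sum.inter_filter[OF finite_lessThan] by (rule sum.cong) auto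
    also have "\<dots> = conj_diag n W (\<lambda>i. if P i then 1 else 0) $$ (a, b)"
      using conj_diag_index[OF conjunct1[OF W] ab] by simp
    finally show "(V * mat_adjoint V) $$ (a, b) = conj_diag n W (\<lambda>i. if P i then 1 else 0) $$ (a, b)" .
  qed (use Vc W in auto)
  ultimately show ?thesis using Vc by blast
qed

text \<open>The Hermitian part \<open>H\<close> of \<open>U\<close> satisfies \<open>U - H = (U - U\<^sup>*)/2\<close> and \<open>H\<^sup>2 - 1 = (U - U\<^sup>*)\<^sup>2/4\<close>, and
  \<open>U - U\<^sup>* = (U\<^sup>2 - 1) U\<^sup>*\<close> is small.  So the spectrum of \<open>H\<close> clusters at \<open>1\<close> and \<open>-1\<close>; replacing each
  eigenvalue by its sign gives a symmetry \<open>1 - 2 V V\<^sup>*\<close>, where the columns of \<open>V\<close> are the eigenvectors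
  of \<open>H\<close> with negative eigenvalue.\<close>

lemma almost_involution_near_symmetry:
  assumes "U \<in> carrier (unitary_group n)"
  shows "\<exists>k V. V \<in> carrier_mat n k \<and> mat_adjoint V * V = 1\<^sub>m k \<and>
    op_norm (U - (1\<^sub>m n - 2 \<cdot>\<^sub>m (V * mat_adjoint V))) \<le> op_norm (U * U - 1\<^sub>m n)"
proof -
  note U = assms[unfolded unitary_group_iff]
  let ?U = "mat_adjoint U"
  define \<epsilon> where "\<epsilon> = op_norm (U * U - 1\<^sub>m n)"
  have Uc: "U \<in> carrier_mat n n" "?U \<in> carrier_mat n n" using U by auto
  have UUc: "U * U \<in> carrier_mat n n" "?U * ?U \<in> carrier_mat n n" "U - ?U \<in> carrier_mat n n"
    using Uc by (auto intro: mult_carrier_mat minus_carrier_mat)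
  note nU = op_norm_unitary[OF assms] op_norm_unitary[OF unitary_group_adjoint[OF assms]]
  \<comment> \<open>turns the quadratic bound \<open>\<epsilon>\<^sup>2/4\<close> below into a linear one\<close>
  have \<epsilon>2: "\<epsilon> \<le> 2" unfolding \<epsilon>_def
    by (rule op_norm_diff_le_2[of _ n n])
      (use UUc op_norm_unitary[OF unitary_group_mult[OF assms assms]] op_norm_unitary[OF one_unitary] in auto)
  have \<epsilon>0: "0 \<le> \<epsilon>" unfolding \<epsilon>_def by (rule op_norm_nonneg)
  have "U - ?U = (U * U - 1\<^sub>m n) * ?U"
  proof -
    have "(U * U) * ?U = U * (U * ?U)" using Uc by (simp add: assoc_mult_mat[of _ n n _ n _ n])
    also have "\<dots> = U" using U by (simp add: right_mult_one_mat[of _ n n])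
    finally have *: "(U * U) * ?U = U" .
    have "(U * U - 1\<^sub>m n) * ?U = (U * U) * ?U - 1\<^sub>m n * ?U"
      using Uc UUc by (intro minus_mult_distrib_mat[of _ n n _ _ n]) auto
    then show ?thesis unfolding * using Uc by (simp add: left_mult_one_mat[of _ n n])
  qed
  then have UU: "op_norm (U - ?U) \<le> \<epsilon>"
    unfolding \<epsilon>_def
    by (simp only:) (rule op_norm_mult_contraction_right[OF minus_carrier_mat[OF one_carrier_mat] Uc(2) order_refl nU(2)])
  define H where "H = (1/2) \<cdot>\<^sub>m (U + ?U)"
  have Hc: "H \<in> carrier_mat n n" unfolding H_def using Uc by auto
  have "mat_adjoint H = H" unfolding H_def using Uc by (intro eq_matI) (auto simp: add.commute)
  from hermitian_spectral[OF Hc this] obtain W d where W: "W \<in> carrier (unitary_group n)"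
    and H: "H = conj_diag n W (\<lambda>i. complex_of_real (d i))" unfolding conj_diag_def by blast
  note W' = W[unfolded unitary_group_iff]
  have UH: "op_norm (U - H) \<le> \<epsilon> / 2"
  proof -
    have "U - H = (1/2) \<cdot>\<^sub>m (U - ?U)" unfolding H_def using Uc by (intro eq_matI) (auto simp: field_simps)
    then show ?thesis using op_norm_smult_le[of "1/2" "U - ?U"] UU by simp
  qed
  have "H * H - 1\<^sub>m n = (1/4) \<cdot>\<^sub>m ((U - ?U) * (U - ?U))"
  proof -
    have p: "(U + ?U) * (U + ?U) = U * U + 1\<^sub>m n + (1\<^sub>m n + ?U * ?U)"
      using U Uc by (simp add: add_mult_distrib_mat[of _ n n _ _ n] mult_add_distrib_mat[of _ n n _ n])
    have m: "(U - ?U) * (U - ?U) = U * U - 1\<^sub>m n - (1\<^sub>m n - ?U * ?U)"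
      using U Uc UUc by (simp add: minus_mult_distrib_mat[of _ n n _ _ n] mult_minus_distrib_mat[of _ n n _ n])
    have "H * H = (1/2) \<cdot>\<^sub>m ((1/2) \<cdot>\<^sub>m ((U + ?U) * (U + ?U)))" unfolding H_def using Uc
      by (simp add: mult_smult_distrib[of _ n n _ n] mult_smult_assoc_mat[of _ n n _ n])
    also have "\<dots> = (1/4) \<cdot>\<^sub>m ((U + ?U) * (U + ?U))"
      by (rule eq_matI) (simp_all del: index_mult_mat(1))
    finally have "H * H = (1/4) \<cdot>\<^sub>m ((U + ?U) * (U + ?U))" .
    moreover have "(1/4) \<cdot>\<^sub>m (A + 1\<^sub>m n + (1\<^sub>m n + B)) - 1\<^sub>m n = (1/4) \<cdot>\<^sub>m (A - 1\<^sub>m n - (1\<^sub>m n - B))"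
      if "A \<in> carrier_mat n n" "B \<in> carrier_mat n n" for A B :: "complex mat"
      using that by (intro eq_matI) (auto simp: field_simps)
    ultimately show ?thesis unfolding p m using UUc by simp
  qed
  moreover have "op_norm ((U - ?U) * (U - ?U)) \<le> \<epsilon> * \<epsilon>"
    using op_norm_mult[OF UUc(3,3)] mult_mono[OF UU UU \<epsilon>0 op_norm_nonneg] by linarith
  ultimately have "op_norm (H * H - 1\<^sub>m n) \<le> \<epsilon> * \<epsilon> / 4"
    using op_norm_smult_le[of "1/4" "(U - ?U) * (U - ?U)"] by simp
  also have "\<dots> \<le> \<epsilon> / 2" using mult_left_mono[OF \<epsilon>2 \<epsilon>0] by simp
  finally have HH: "op_norm (H * H - 1\<^sub>m n) \<le> \<epsilon> / 2" .
  have HH': "H * H - 1\<^sub>m n = conj_diag n W (\<lambda>i. complex_of_real ((d i)\<^sup>2 - 1))"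
    unfolding H conj_diag_mult[OF W] conj_diag_one[OF W, symmetric] using W'
    by (simp add: conj_diag_diff power2_eq_square)
  define s where "s i = (if d i < 0 then -1 else 1 :: real)" for i
  have ds: "\<bar>d i - s i\<bar> \<le> \<epsilon> / 2" if "i < n" for i
  proof -
    have "\<bar>d i - s i\<bar> \<le> \<bar>(d i)\<^sup>2 - 1\<bar>" unfolding s_def by (rule dist_sign_le)
    also have "\<dots> = cmod (complex_of_real ((d i)\<^sup>2 - 1))" unfolding norm_of_real ..
    also have "\<dots> \<le> op_norm (H * H - 1\<^sub>m n)" unfolding HH' by (rule cmod_coeff_le_op_norm_conj_diag[OF W that])
    finally show ?thesis using HH by simp
  qed
  define S where "S = conj_diag n W (\<lambda>i. complex_of_real (s i))"
  have Sc: "S \<in> carrier_mat n n" unfolding S_def using W' by simp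
  have HS: "op_norm (H - S) \<le> \<epsilon> / 2"
  proof -
    have "H - S = conj_diag n W (\<lambda>i. complex_of_real (d i - s i))"
      unfolding H S_def using W' by (simp add: conj_diag_diff)
    moreover have "op_norm \<dots> \<le> \<epsilon> / 2"
      by (rule op_norm_conj_diag_le[OF W]) (use \<epsilon>0 in simp, simp only: norm_of_real ds)
    ultimately show ?thesis by simp
  qed
  have US: "op_norm (U - S) \<le> \<epsilon>" using op_norm_triangle[OF Uc(1) Hc Sc] UH HS by simp
  obtain k V where V: "V \<in> carrier_mat n k" "mat_adjoint V * V = 1\<^sub>m k"
    and VV: "V * mat_adjoint V = conj_diag n W (\<lambda>i. if d i < 0 then 1 else 0)"
    using eigencolumns_isometry[OF W, of "\<lambda>i. d i < 0"] by blast
  have "S = 1\<^sub>m n - 2 \<cdot>\<^sub>m (V * mat_adjoint V)"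
    unfolding VV conj_diag_one[OF W, symmetric] S_def
  proof (rule eq_matI)
    fix a b assume "a < dim_row (conj_diag n W (\<lambda>_. 1) - 2 \<cdot>\<^sub>m conj_diag n W (\<lambda>i. if d i < 0 then 1 else 0))"
      "b < dim_col (conj_diag n W (\<lambda>_. 1) - 2 \<cdot>\<^sub>m conj_diag n W (\<lambda>i. if d i < 0 then 1 else 0))"
    then have ab: "a < n" "b < n" using W' by auto
    have Wc: "W \<in> carrier_mat n n" using W' by simp
    have "(conj_diag n W (\<lambda>_. 1) - 2 \<cdot>\<^sub>m conj_diag n W (\<lambda>i. if d i < 0 then 1 else 0)) $$ (a, b) =
      conj_diag n W (\<lambda>_. 1) $$ (a, b) - 2 * conj_diag n W (\<lambda>i. if d i < 0 then 1 else 0) $$ (a, b)"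
      using ab carrier_matD[OF Wc] by simp
    also have "\<dots> = conj_diag n W (\<lambda>i. complex_of_real (s i)) $$ (a, b)"
      unfolding conj_diag_index[OF Wc ab] sum_distrib_left sum_subtractf[symmetric]
      by (rule sum.cong) (auto simp: s_def)
    finally show "conj_diag n W (\<lambda>i. complex_of_real (s i)) $$ (a, b) =
      (conj_diag n W (\<lambda>_. 1) - 2 \<cdot>\<^sub>m conj_diag n W (\<lambda>i. if d i < 0 then 1 else 0)) $$ (a, b)" by simp
  qed (use W' in auto)
  then show ?thesis using V US unfolding \<epsilon>_def by blast
qed

section \<open>Compression to the (-1)-eigenspace\<close>

lemma op_norm_mult_diff_left:
  assumes "A \<in> carrier_mat n m" "B \<in> carrier_mat m k" "C \<in> carrier_mat m k" "op_norm A \<le> 1"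
  shows "op_norm (A * B - A * C) \<le> op_norm (B - C)"
proof -
  have "A * B - A * C = A * (B - C)" using assms by (simp add: mult_minus_distrib_mat[of A n m])
  then show ?thesis
    using op_norm_mult_contraction_left[OF assms(1) minus_carrier_mat[OF assms(3)] assms(4) order_refl op_norm_nonneg]
    by metis
qed

lemma op_norm_mult_diff_right:
  assumes "A \<in> carrier_mat m k" "B \<in> carrier_mat n m" "C \<in> carrier_mat n m" "op_norm A \<le> 1"
  shows "op_norm (B * A - C * A) \<le> op_norm (B - C)"
proof -
  have "B * A - C * A = (B - C) * A" using assms by (simp add: minus_mult_distrib_mat[of _ n m])
  then show ?thesis
    using op_norm_mult_contraction_right[OF minus_carrier_mat[OF assms(3)] assms(1) order_refl assms(4)]
    by metis
qed

lemma compression_carrier: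
  "V \<in> carrier_mat n k \<Longrightarrow> A \<in> carrier_mat n n \<Longrightarrow> mat_adjoint V * A * V \<in> carrier_mat k k"
  by (auto intro!: mult_carrier_mat[of _ k n])

lemma op_norm_compression_diff:
  assumes V: "V \<in> carrier_mat n k" "mat_adjoint V * V = 1\<^sub>m k"
    and A: "A \<in> carrier_mat n n" "B \<in> carrier_mat n n"
  shows "op_norm (mat_adjoint V * A * V - mat_adjoint V * B * V) \<le> op_norm (A - B)"
proof -
  have V': "mat_adjoint V \<in> carrier_mat k n" using V by simp
  have "op_norm (mat_adjoint V * A * V - mat_adjoint V * B * V) \<le> op_norm (mat_adjoint V * A - mat_adjoint V * B)"
    by (rule op_norm_mult_diff_right[of _ n k _ k]) (use V V' A op_norm_isometry[OF V] in \<open>auto intro!: mult_carrier_mat[of _ k n _ n]\<close>)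
  also have "\<dots> \<le> op_norm (A - B)"
    by (rule op_norm_mult_diff_left[of _ k n _ n]) (use V' A op_norm_isometry[OF V] in auto)
  finally show ?thesis .
qed

text \<open>With \<open>P V = V\<close>, the difference equals \<open>V\<^sup>* A (P B - B P) V\<close>.\<close>

lemma compression_almost_multiplicative:
  assumes V: "V \<in> carrier_mat n k" "mat_adjoint V * V = 1\<^sub>m k"
    and A: "A \<in> carrier_mat n n" "op_norm A \<le> 1" and B: "B \<in> carrier_mat n n"
  defines "P \<equiv> V * mat_adjoint V"
  shows "op_norm ((mat_adjoint V * A * V) * (mat_adjoint V * B * V) - mat_adjoint V * (A * B) * V) \<le> op_norm (P * B - B * P)"
proof -
  let ?V = "mat_adjoint V"
  have V': "?V \<in> carrier_mat k n" using V by simp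
  have Pc: "P \<in> carrier_mat n n" unfolding P_def by (rule mult_carrier_mat[OF V(1) V'])
  have AP: "A * (P * B) \<in> carrier_mat n n" "A * (B * P) \<in> carrier_mat n n"
    using A B Pc by (auto intro!: mult_carrier_mat[of _ n n])
  have PV: "P * V = V" unfolding P_def using V V'
    by (simp add: assoc_mult_mat[of _ n k _ n _ k] right_mult_one_mat[of _ n k])
  have 1: "(?V * A * V) * (?V * B * V) = ?V * (A * (P * B)) * V"
    unfolding P_def using V(1) V' A B
    by (simp add: assoc_mult_mat[of _ k n _ n _ n] assoc_mult_mat[of _ k n _ n _ k] assoc_mult_mat[of _ k n _ k _ k]
        assoc_mult_mat[of _ n n _ n _ k] assoc_mult_mat[of _ n k _ n _ n] assoc_mult_mat[of _ n k _ n _ k]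
        assoc_mult_mat[of _ n n _ k _ k] assoc_mult_mat[of _ n n _ k _ n] assoc_mult_mat[of _ n n _ n _ n]
        mult_carrier_mat[of _ n n _ n] mult_carrier_mat[of _ n n _ k] mult_carrier_mat[of _ k n _ n]
        mult_carrier_mat[of _ n k _ n] mult_carrier_mat[of _ k n _ k])
  have 2: "?V * (A * B) * V = ?V * (A * (B * P)) * V"
  proof -
    have "A * (B * P) * V = A * (B * (P * V))" using V(1) Pc A B
      by (simp add: assoc_mult_mat[of _ n n _ n _ k] mult_carrier_mat[of _ n n _ n] mult_carrier_mat[of _ n n _ k])
    also have "\<dots> = A * B * V" unfolding PV using V(1) A B
      by (simp add: assoc_mult_mat[of _ n n _ n _ k])
    finally show ?thesis using V(1) V' AP A B
      by (simp add: assoc_mult_mat[of ?V k n _ n V k] mult_carrier_mat[of A n n B n])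
  qed
  have "op_norm (?V * (A * (P * B)) * V - ?V * (A * (B * P)) * V) \<le> op_norm (A * (P * B) - A * (B * P))"
    by (rule op_norm_compression_diff[OF V AP])
  also have "\<dots> \<le> op_norm (P * B - B * P)"
    by (rule op_norm_mult_diff_left[of _ n n _ n]) (use A B Pc in \<open>auto intro!: mult_carrier_mat[of _ n n]\<close>)
  finally show ?thesis unfolding 1 2 .
qed

text \<open>This is almost multiplicativity of the compression for the product \<open>A\<^sup>* A = 1\<close>.\<close>

lemma compression_almost_unitary:
  assumes V: "V \<in> carrier_mat n k" "mat_adjoint V * V = 1\<^sub>m k"
    and A: "A \<in> carrier (unitary_group n)"
  defines "P \<equiv> V * mat_adjoint V" and "Y \<equiv> mat_adjoint V * A * V"
  shows "op_norm (mat_adjoint Y * Y - 1\<^sub>m k) \<le> op_norm (P * A - A * P)"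
proof -
  let ?V = "mat_adjoint V"
  have V': "?V \<in> carrier_mat k n" using V by simp
  note A' = A[unfolded unitary_group_iff]
  have Ac: "A \<in> carrier_mat n n" using A' by simp
  have "mat_adjoint Y = ?V * (mat_adjoint A * V)"
    unfolding Y_def mat_adjoint_mult[OF mult_carrier_mat[OF V' Ac] V(1)] mat_adjoint_mult[OF V' Ac] by simp
  also have "\<dots> = ?V * mat_adjoint A * V"
    by (rule assoc_mult_mat[symmetric, OF V' mat_adjoint_carrier[OF Ac] V(1)])
  finally have "mat_adjoint Y = ?V * mat_adjoint A * V" .
  moreover have "?V * (mat_adjoint A * A) * V = 1\<^sub>m k"
    using A' V V' by (simp add: right_mult_one_mat[of _ k n])
  ultimately show ?thesis
    using compression_almost_multiplicative[OF V, of "mat_adjoint A" A] A' op_norm_unitary[OF unitary_group_adjoint[OF A]]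
    unfolding P_def Y_def by simp
qed

lemma op_norm_compression_le:
  assumes V: "V \<in> carrier_mat n k" "mat_adjoint V * V = 1\<^sub>m k"
    and A: "A \<in> carrier_mat n n" "op_norm A \<le> 1"
  shows "op_norm (mat_adjoint V * A * V) \<le> 1"
proof -
  have V': "mat_adjoint V \<in> carrier_mat k n" using V by simp
  have "op_norm (mat_adjoint V * A) \<le> 1"
    by (rule op_norm_mult_contraction_left[OF V' A(1)]) (use A op_norm_isometry[OF V] in auto)
  then show ?thesis
    by (rule op_norm_mult_contraction_right[OF mult_carrier_mat[OF V' A(1)] V(1) _ op_norm_isometry(1)[OF V]])
qed

text \<open>Multiply \<open>U\<^sup>2 - U\<close> by \<open>U\<^sup>*\<close>.  It is applied to the value of an approximate homomorphism at the
  neutral element, which is thereby close to \<open>1\<close>.\<close>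

lemma unitary_idempotent_defect:
  assumes U: "U \<in> carrier (unitary_group n)"
  shows "op_norm (U - 1\<^sub>m n) \<le> op_norm (U * U - U)"
proof -
  note U' = U[unfolded unitary_group_iff]
  have "(U * U) * mat_adjoint U = U * (U * mat_adjoint U)"
    using U' by (intro assoc_mult_mat[of _ n n _ n _ n]) auto
  then have "(U * U) * mat_adjoint U = U" using U' by (simp add: right_mult_one_mat[of _ n n])
  then have "U - 1\<^sub>m n = (U * U) * mat_adjoint U - U * mat_adjoint U" using U' by simp
  then show ?thesis
    using op_norm_mult_diff_right[of "mat_adjoint U" n n "U * U" n U] U' op_norm_unitary[OF unitary_group_adjoint[OF U]]
    by (auto intro!: mult_carrier_mat[of _ n n])
qed

definition defect :: "('a, 'b) monoid_scheme \<Rightarrow> ('a \<Rightarrow> complex mat) \<Rightarrow> 'a \<Rightarrow> 'a \<Rightarrow> real" where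
  "defect G T g h = op_norm (T (g \<otimes>\<^bsub>G\<^esub> h) - T g * T h)"

text \<open>A bound for the commutator of \<open>T g\<close> with the projection to the approximate \<open>(-1)\<close>-eigenspace of \<open>T J\<close>, in terms
  of multiplicativity defects only.\<close>

definition commutator_defect :: "('a, 'b) monoid_scheme \<Rightarrow> ('a \<Rightarrow> complex mat) \<Rightarrow> 'a \<Rightarrow> 'a \<Rightarrow> real" where
  "commutator_defect G T J g =
     (defect G T J g + defect G T g J) / 2 + (defect G T J J + defect G T \<one>\<^bsub>G\<^esub> \<one>\<^bsub>G\<^esub>)"

text \<open>All estimates are stated for a single map \<open>T\<close> and hold without smallness assumptions, so that the
  asymptotic statement follows by letting the defects tend to \<open>0\<close>.  Dimension \<open>k = 0\<close> is possible
  only if \<open>T J\<close> is close to \<open>1\<close>.\<close>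

lemma compression_to_minus_one_eigenspace:
  fixes G (structure)
  assumes G: "group G" and T: "T \<in> carrier G \<rightarrow> carrier (unitary_group n)"
    and J: "J \<in> carrier G" "J \<otimes> J = \<one>" and central: "\<And>g. g \<in> carrier G \<Longrightarrow> J \<otimes> g = g \<otimes> J"
  defines "c \<equiv> commutator_defect G T J"
    and "\<epsilon> \<equiv> defect G T J J + defect G T \<one> \<one>"
  shows "\<exists>k \<theta>. \<theta> \<in> carrier G \<rightarrow> carrier (unitary_group k) \<and>
    (k = 0 \<longrightarrow> op_norm (T J - 1\<^sub>m n) \<le> \<epsilon>) \<and>
    (\<forall>g\<in>carrier G. \<forall>h\<in>carrier G.
       defect G \<theta> g h \<le> 2 * c (g \<otimes> h) + defect G T g h + 2 * c g + 3 * c h) \<and>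
    op_norm (\<theta> J - (- 1\<^sub>m k)) \<le> 2 * c J + \<epsilon>"
proof -
  interpret group G by (rule G)
  have Tu: "T g \<in> carrier (unitary_group n)" if "g \<in> carrier G" for g using T that by auto
  have Tc [simp]: "T g \<in> carrier_mat n n" if "g \<in> carrier G" for g using Tu[OF that] unitary_group_iff by auto
  have TTc [simp]: "T g * T h \<in> carrier_mat n n" if "g \<in> carrier G" "h \<in> carrier G" for g h
    using Tc that by (intro mult_carrier_mat[of _ n n]) auto
  have Tn: "op_norm (T g) \<le> 1" if "g \<in> carrier G" for g by (rule op_norm_unitary[OF Tu[OF that]])
  have sq: "op_norm (T J * T J - 1\<^sub>m n) \<le> \<epsilon>"
  proof -
    have "op_norm (T J * T J - 1\<^sub>m n) \<le> op_norm (T J * T J - T \<one>) + op_norm (T \<one> - 1\<^sub>m n)"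
      by (rule op_norm_triangle[of _ n n]) (use J in auto)
    also have "op_norm (T J * T J - T \<one>) = defect G T J J"
      unfolding defect_def J(2) by (rule op_norm_minus_commute[of _ n n]) (use J in auto)
    also have "op_norm (T \<one> - 1\<^sub>m n) \<le> op_norm (T \<one> * T \<one> - T \<one>)"
      by (rule unitary_idempotent_defect[OF Tu]) simp
    also have "\<dots> = defect G T \<one> \<one>"
      unfolding defect_def by (subst op_norm_minus_commute[of _ n n]) auto
    finally show ?thesis unfolding \<epsilon>_def by simp
  qed
  obtain k V where V: "V \<in> carrier_mat n k" "mat_adjoint V * V = 1\<^sub>m k"
    and VJ: "op_norm (T J - (1\<^sub>m n - 2 \<cdot>\<^sub>m (V * mat_adjoint V))) \<le> op_norm (T J * T J - 1\<^sub>m n)"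
    using almost_involution_near_symmetry[OF Tu[OF J(1)]] by blast
  let ?V = "mat_adjoint V"
  have V': "?V \<in> carrier_mat k n" using V by simp
  define P where "P = V * ?V"
  define S where "S = 1\<^sub>m n - 2 \<cdot>\<^sub>m P"
  have Pc: "P \<in> carrier_mat n n" unfolding P_def by (rule mult_carrier_mat[OF V(1) V'])
  have Sc: "S \<in> carrier_mat n n" unfolding S_def using Pc by (auto intro: minus_carrier_mat)
  have TS: "op_norm (T J - S) \<le> \<epsilon>" using VJ sq unfolding S_def P_def by simp
  have comm: "op_norm (P * T g - T g * P) \<le> c g" if g: "g \<in> carrier G" for g
  proof -
    have Ac: "T g * S \<in> carrier_mat n n" "S * T g \<in> carrier_mat n n" "P * T g \<in> carrier_mat n n" "T g * P \<in> carrier_mat n n"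
      using Tc[OF g] Sc Pc by (auto intro!: mult_carrier_mat[of _ n n])
    have "T g * S = T g - 2 \<cdot>\<^sub>m (T g * P)" "S * T g = T g - 2 \<cdot>\<^sub>m (P * T g)"
      unfolding S_def using Tc[OF g] Pc
      by (simp_all add: minus_mult_distrib_mat[of _ n n _ _ n] mult_minus_distrib_mat[of _ n n _ n]
          mult_smult_distrib[of _ n n _ n] mult_smult_assoc_mat[of _ n n _ n]
          left_mult_one_mat[of _ n n] right_mult_one_mat[of _ n n])
    moreover have "B - A = (1/2) \<cdot>\<^sub>m ((C - 2 \<cdot>\<^sub>m A) - (C - 2 \<cdot>\<^sub>m B))"
      if "A \<in> carrier_mat n n" "B \<in> carrier_mat n n" "C \<in> carrier_mat n n" for A B C :: "complex mat"
      using that by (intro eq_matI) (auto simp: field_simps)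
    ultimately have "P * T g - T g * P = (1/2) \<cdot>\<^sub>m (T g * S - S * T g)"
      using Ac(3,4) Tc[OF g] by metis
    then have "op_norm (P * T g - T g * P) \<le> 1/2 * op_norm (T g * S - S * T g)"
      using op_norm_smult_le[of "1/2" "T g * S - S * T g"] by simp
    \<comment> \<open>replace \<open>S\<close> by \<open>T J\<close> on both sides; centrality of \<open>J\<close> handles the rest\<close>
    also have "op_norm (T g * S - S * T g) \<le> op_norm (T g * S - T g * T J) + op_norm (T g * T J - S * T g)"
      by (rule op_norm_triangle[of _ n n]) (use Ac g J in auto)
    also have "op_norm (T g * S - T g * T J) \<le> op_norm (S - T J)"
      by (rule op_norm_mult_diff_left[of _ n n _ n]) (use Sc g J Tn in auto)
    also have "op_norm (S - T J) = op_norm (T J - S)" by (rule op_norm_minus_commute[of _ n n]) (use Sc J in auto)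
    also have "op_norm (T g * T J - S * T g) \<le> op_norm (T g * T J - T J * T g) + op_norm (T J * T g - S * T g)"
      by (rule op_norm_triangle[of _ n n]) (use Ac g J in auto)
    also have "op_norm (T J * T g - S * T g) \<le> op_norm (T J - S)"
      by (rule op_norm_mult_diff_right[of _ n n _ n]) (use Sc g J Tn in auto)
    also have "op_norm (T g * T J - T J * T g) \<le> op_norm (T g * T J - T (g \<otimes> J)) + op_norm (T (g \<otimes> J) - T J * T g)"
      by (rule op_norm_triangle[of _ n n]) (use g J in auto)
    also have "op_norm (T g * T J - T (g \<otimes> J)) = defect G T g J"
      unfolding defect_def by (rule op_norm_minus_commute[of _ n n]) (use g J in auto)
    also have "op_norm (T (g \<otimes> J) - T J * T g) = defect G T J g"
      unfolding defect_def central[OF g] ..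
    finally have "op_norm (P * T g - T g * P) \<le>
        1/2 * (op_norm (T J - S) + (defect G T g J + defect G T J g + op_norm (T J - S)))"
      by simp
    moreover have "x \<le> (b + a) / 2 + e" if "x \<le> 1/2 * (s + (a + b + s))" "s \<le> e" for x a b s e :: real
      using that by argo
    ultimately show ?thesis using TS unfolding c_def commutator_defect_def \<epsilon>_def by blast
  qed
  define Y where "Y g = ?V * T g * V" for g
  have Yc [simp]: "Y g \<in> carrier_mat k k" if "g \<in> carrier G" for g
    unfolding Y_def by (rule compression_carrier[OF V(1) Tc[OF that]])
  have Yn: "op_norm (Y g) \<le> 1" if "g \<in> carrier G" for g
    unfolding Y_def by (rule op_norm_compression_le[OF V Tc[OF that] Tn[OF that]])
  have "\<exists>U. g \<in> carrier G \<longrightarrow> U \<in> carrier (unitary_group k) \<and> op_norm (Y g - U) \<le> 2 * c g" for g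
  proof (cases "g \<in> carrier G")
    case True
    have "op_norm (mat_adjoint (Y g) * Y g - 1\<^sub>m k) \<le> c g"
      using compression_almost_unitary[OF V Tu[OF True]] comm[OF True] unfolding P_def Y_def by simp
    then show ?thesis using contraction_near_unitary[OF Yc[OF True] Yn[OF True]] by force
  qed simp
  then obtain \<theta> where \<theta>: "\<And>g. g \<in> carrier G \<Longrightarrow> \<theta> g \<in> carrier (unitary_group k)"
    and Y\<theta>: "\<And>g. g \<in> carrier G \<Longrightarrow> op_norm (Y g - \<theta> g) \<le> 2 * c g" by metis
  have \<theta>c [simp]: "\<theta> g \<in> carrier_mat k k" if "g \<in> carrier G" for g using \<theta>[OF that] unitary_group_iff by auto
  have prod [simp]: "\<theta> g * \<theta> h \<in> carrier_mat k k" "Y g * Y h \<in> carrier_mat k k" "Y g * \<theta> h \<in> carrier_mat k k"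
    if "g \<in> carrier G" "h \<in> carrier G" for g h
    using that by (auto intro!: mult_carrier_mat[of _ k k])
  have mult: "defect G \<theta> g h \<le> 2 * c (g \<otimes> h) + defect G T g h + 2 * c g + 3 * c h"
    if g: "g \<in> carrier G" and h: "h \<in> carrier G" for g h
  proof -
    have gh: "g \<otimes> h \<in> carrier G" using g h by simp
    have "defect G \<theta> g h \<le> op_norm (\<theta> (g \<otimes> h) - Y (g \<otimes> h)) + op_norm (Y (g \<otimes> h) - \<theta> g * \<theta> h)"
      unfolding defect_def by (rule op_norm_triangle[of _ k k]) (use g h in auto)
    also have "op_norm (\<theta> (g \<otimes> h) - Y (g \<otimes> h)) = op_norm (Y (g \<otimes> h) - \<theta> (g \<otimes> h))"
      by (rule op_norm_minus_commute[of _ k k]) (use g h in auto)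
    also have "\<dots> \<le> 2 * c (g \<otimes> h)" by (rule Y\<theta>[OF gh])
    also have "op_norm (Y (g \<otimes> h) - \<theta> g * \<theta> h) \<le> op_norm (Y (g \<otimes> h) - Y g * Y h) + op_norm (Y g * Y h - \<theta> g * \<theta> h)"
      by (rule op_norm_triangle[of _ k k]) (use g h in auto)
    also have "op_norm (Y g * Y h - \<theta> g * \<theta> h) \<le> op_norm (Y g * Y h - Y g * \<theta> h) + op_norm (Y g * \<theta> h - \<theta> g * \<theta> h)"
      by (rule op_norm_triangle[of _ k k]) (use g h in auto)
    also have "op_norm (Y g * Y h - Y g * \<theta> h) \<le> op_norm (Y h - \<theta> h)"
      by (rule op_norm_mult_diff_left[of _ k k _ k]) (use g h Yn in auto)
    also have "\<dots> \<le> 2 * c h" by (rule Y\<theta>[OF h])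
    also have "op_norm (Y g * \<theta> h - \<theta> g * \<theta> h) \<le> op_norm (Y g - \<theta> g)"
      by (rule op_norm_mult_diff_right[of _ k k _ k]) (use g h op_norm_unitary[OF \<theta>[OF h]] in auto)
    also have "\<dots> \<le> 2 * c g" by (rule Y\<theta>[OF g])
    \<comment> \<open>compare through the compression of \<open>T g * T h\<close>\<close>
    also have "op_norm (Y (g \<otimes> h) - Y g * Y h) \<le>
        op_norm (Y (g \<otimes> h) - ?V * (T g * T h) * V) + op_norm (?V * (T g * T h) * V - Y g * Y h)"
      by (rule op_norm_triangle[of _ k k]) (use g h compression_carrier[OF V(1) TTc[OF g h]] in auto)
    also have "op_norm (Y (g \<otimes> h) - ?V * (T g * T h) * V) \<le> defect G T g h"
      unfolding Y_def defect_def by (rule op_norm_compression_diff[OF V]) (use g h in auto)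
    also have "op_norm (?V * (T g * T h) * V - Y g * Y h) = op_norm (Y g * Y h - ?V * (T g * T h) * V)"
      by (rule op_norm_minus_commute[of _ k k]) (use g h compression_carrier[OF V(1) TTc[OF g h]] in auto)
    also have "\<dots> \<le> op_norm (P * T h - T h * P)"
      unfolding Y_def P_def
      by (rule compression_almost_multiplicative[OF V Tc[OF g] Tn[OF g] Tc[OF h]])
    also have "\<dots> \<le> c h" by (rule comm[OF h])
    finally show ?thesis by simp
  qed
  have "op_norm (\<theta> J - (- 1\<^sub>m k)) \<le> 2 * c J + \<epsilon>"
  proof -
    have "?V * S * V = - 1\<^sub>m k"
    proof -
      have PV: "P * V = V" unfolding P_def using V V'
        by (simp add: assoc_mult_mat[of _ n k _ n _ k] right_mult_one_mat[of _ n k])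
      have "?V * S * V = ?V * (S * V)" using V(1) V' Sc by (intro assoc_mult_mat[of _ k n _ n _ k]) auto
      also have "S * V = V - 2 \<cdot>\<^sub>m V"
        unfolding S_def using Pc V PV
        by (simp add: minus_mult_distrib_mat[of _ n n _ _ k] mult_smult_assoc_mat[of _ n n _ k] left_mult_one_mat[of _ n k])
      also have "\<dots> = (-1) \<cdot>\<^sub>m V" using V by (intro eq_matI) auto
      also have "?V * ((-1) \<cdot>\<^sub>m V) = (-1) \<cdot>\<^sub>m 1\<^sub>m k" using V V' by (simp add: mult_smult_distrib[of _ k n _ k])
      also have "\<dots> = - 1\<^sub>m k" by (intro eq_matI) auto
      finally show ?thesis .
    qed
    then have YS: "op_norm (Y J - (- 1\<^sub>m k)) \<le> op_norm (T J - S)"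
      using op_norm_compression_diff[OF V Tc[OF J(1)] Sc] unfolding Y_def by simp
    have "op_norm (\<theta> J - (- 1\<^sub>m k)) \<le> op_norm (\<theta> J - Y J) + op_norm (Y J - (- 1\<^sub>m k))"
      by (rule op_norm_triangle[of _ k k]) (use J in auto)
    also have "op_norm (\<theta> J - Y J) = op_norm (Y J - \<theta> J)"
      by (rule op_norm_minus_commute[of _ k k]) (use J in auto)
    finally show ?thesis using Y\<theta>[OF J(1)] YS TS by linarith
  qed
  moreover have "op_norm (T J - 1\<^sub>m n) \<le> \<epsilon>" if "k = 0"
  proof -
    have "S = 1\<^sub>m n" unfolding S_def P_def using V(1) that
      by (intro eq_matI) (auto simp: scalar_prod_def)
    then show ?thesis using TS by simp
  qed
  moreover have "\<theta> \<in> carrier G \<rightarrow> carrier (unitary_group k)" using \<theta> by auto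
  ultimately show ?thesis using mult by (intro exI[of _ k] exI[of _ \<theta>]) simp
qed

section \<open>Groups of Deligne type are not MF\<close>

text \<open>For every vector, \<open>2 v = (A + 1) v - (A - 1) v\<close>, so \<open>\<parallel>(A - 1) v\<parallel> \<ge> \<parallel>v\<parallel>\<close>.\<close>

lemma HS_norm_minus_one_ge_1:
  assumes A: "A \<in> carrier_mat k k" and "k > 0" and close: "op_norm (A - (- 1\<^sub>m k)) \<le> 1"
  shows "1 \<le> HS_norm (A - 1\<^sub>m k)"
proof (rule HS_norm_ge[of _ k])
  fix v :: "complex vec" assume v: "v \<in> carrier_vec k"
  let ?p = "(A - (- 1\<^sub>m k)) *\<^sub>v v" and ?m = "(A - 1\<^sub>m k) *\<^sub>v v"
  have pc: "A - (- 1\<^sub>m k) \<in> carrier_mat k k" and mc: "A - 1\<^sub>m k \<in> carrier_mat k k"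
    by (auto intro: minus_carrier_mat)
  have p: "?p = A *\<^sub>v v + v"
  proof -
    have "A - (- 1\<^sub>m k) = A + 1\<^sub>m k" using A by (intro eq_matI) auto
    then show ?thesis using A v by (simp add: add_mult_distrib_mat_vec[of _ k k])
  qed
  have m: "?m = A *\<^sub>v v - v" using A v by (simp add: minus_mult_distrib_mat_vec[of _ k k])
  have Av: "A *\<^sub>v v \<in> carrier_vec k" by (rule mult_mat_vec_carrier[OF A v])
  have "2 \<cdot>\<^sub>v v = ?p + (-1) \<cdot>\<^sub>v ?m" unfolding p m using v Av by (intro eq_vecI) auto
  then have "l2_norm (2 \<cdot>\<^sub>v v) \<le> l2_norm ?p + l2_norm ((-1) \<cdot>\<^sub>v ?m)"
    using l2_norm_triangle[of ?p k "(-1) \<cdot>\<^sub>v ?m"] mult_mat_vec_carrier[OF pc v] mult_mat_vec_carrier[OF mc v] by simp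
  moreover have "l2_norm ?p \<le> 1 * l2_norm v"
    using l2_norm_mult_mat_vec_le[OF pc v] mult_right_mono[OF close l2_norm_nonneg[of v]] by linarith
  ultimately show "1 * l2_norm v \<le> l2_norm ?m" by simp
qed (use assms in \<open>auto intro: minus_carrier_mat\<close>)

lemma hom_unitary_group_one:
  assumes "group G" "\<psi> \<in> hom G (unitary_group k)"
  shows "\<psi> \<one>\<^bsub>G\<^esub> = 1\<^sub>m k"
proof -
  interpret group G by fact
  let ?U = "\<psi> \<one>\<^bsub>G\<^esub>"
  have U: "?U \<in> carrier (unitary_group k)" using assms(2) by (auto simp: hom_def)
  have "\<psi> (\<one>\<^bsub>G\<^esub> \<otimes>\<^bsub>G\<^esub> \<one>\<^bsub>G\<^esub>) = ?U * ?U"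
    using hom_mult[OF assms(2) one_closed one_closed] by (simp add: unitary_group_def)
  then have idem: "?U * ?U = ?U" by simp
  note U' = U[unfolded unitary_group_iff]
  have "1\<^sub>m k = mat_adjoint ?U * (?U * ?U)" unfolding idem using U' by simp
  also have "\<dots> = (mat_adjoint ?U * ?U) * ?U"
    using U' by (intro assoc_mult_mat[symmetric, of _ k k _ k _ k]) auto
  also have "\<dots> = ?U" using U' by (simp add: left_mult_one_mat[of _ k k])
  finally show ?thesis by simp
qed

lemma hom_unitary_group_kills_ker_RF:
  assumes "finitely_generated_group G" "\<psi> \<in> hom G (unitary_group k)" "x \<in> ker_RF G"
  shows "\<psi> x = 1\<^sub>m k"
proof -
  interpret group G using assms(1) unfolding finitely_generated_group_def by blast
  interpret matrix_representation G \<psi> k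
  proof
    show "\<psi> g \<in> carrier_mat k k" if "g \<in> carrier G" for g
      using assms(2) that by (auto simp: hom_def unitary_group_def)
    show "\<psi> (g \<otimes>\<^bsub>G\<^esub> h) = \<psi> g * \<psi> h" if "g \<in> carrier G" "h \<in> carrier G" for g h
      using assms(2) that by (auto simp: hom_def unitary_group_def)
    show "\<psi> \<one>\<^bsub>G\<^esub> = 1\<^sub>m k" by (rule hom_unitary_group_one[OF is_group assms(2)])
  qed
  show ?thesis by (rule trivial_on_ker_RF[OF assms(1,3)])
qed

text \<open>The corners of dimension \<open>0\<close> occur only for finitely many \<open>n\<close>, because \<open>\<phi>\<^sub>n(J)\<close> stays away from \<open>1\<close>;
  there, and at the index \<open>0\<close>, the trivial one-dimensional representation is substituted.\<close>

lemma MF_involution_asymptotic_hom: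
  assumes G: "group G" and J: "J \<in> carrier G" "J \<otimes>\<^bsub>G\<^esub> J = \<one>\<^bsub>G\<^esub>" "J \<noteq> \<one>\<^bsub>G\<^esub>"
    and central: "\<And>g. g \<in> carrier G \<Longrightarrow> J \<otimes>\<^bsub>G\<^esub> g = g \<otimes>\<^bsub>G\<^esub> J" and MF: "MF G"
  shows "\<exists>k \<theta>. op_asymptotic_hom G k \<theta> \<and> (\<lambda>n. op_norm (\<theta> n J - (- 1\<^sub>m (k n)))) \<longlonglongrightarrow> 0"
proof -
  interpret group G by (rule G)
  obtain \<phi> where \<phi>: "\<And>n. n \<ge> 1 \<Longrightarrow> \<phi> n \<in> carrier G \<rightarrow> carrier (unitary_group n)"
    and lim: "\<And>g h. g \<in> carrier G \<Longrightarrow> h \<in> carrier G \<Longrightarrow> (\<lambda>n. defect G (\<phi> n) g h) \<longlonglongrightarrow> 0"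
    and sep: "liminf (\<lambda>n. ereal (op_norm (\<phi> n J - 1\<^sub>m n))) > 0"
    using MF J(1,3) unfolding MF_def defect_def by blast
  define \<epsilon> where "\<epsilon> n = defect G (\<phi> n) J J + defect G (\<phi> n) \<one>\<^bsub>G\<^esub> \<one>\<^bsub>G\<^esub>" for n
  define c where "c n = commutator_defect G (\<phi> n) J" for n
  have \<epsilon>_lim: "\<epsilon> \<longlonglongrightarrow> 0" unfolding \<epsilon>_def using lim[OF J(1) J(1)] lim[OF one_closed one_closed]
    by (rule tendsto_add_zero)
  have c_lim: "(\<lambda>n. c n g) \<longlonglongrightarrow> 0" if g: "g \<in> carrier G" for g
    unfolding c_def commutator_defect_def \<epsilon>_def[symmetric]
    by (intro tendsto_add_zero tendsto_divide_zero lim g J(1) \<epsilon>_lim)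
  let ?bound = "\<lambda>n g h. 2 * c n (g \<otimes>\<^bsub>G\<^esub> h) + defect G (\<phi> n) g h + 2 * c n g + 3 * c n h"
  have "\<exists>k \<theta>. n \<ge> 1 \<longrightarrow> \<theta> \<in> carrier G \<rightarrow> carrier (unitary_group k) \<and>
    (k = 0 \<longrightarrow> op_norm (\<phi> n J - 1\<^sub>m n) \<le> \<epsilon> n) \<and>
    (\<forall>g\<in>carrier G. \<forall>h\<in>carrier G. defect G \<theta> g h \<le> ?bound n g h) \<and>
    op_norm (\<theta> J - (- 1\<^sub>m k)) \<le> 2 * c n J + \<epsilon> n" for n
    using compression_to_minus_one_eigenspace[OF G \<phi> J(1,2) central] unfolding \<epsilon>_def c_def
    by (cases "n \<ge> 1") blast+
  then obtain k0 \<theta>0 where k0: "\<And>n. n \<ge> 1 \<Longrightarrow> \<theta>0 n \<in> carrier G \<rightarrow> carrier (unitary_group (k0 n))"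
    "\<And>n. n \<ge> 1 \<Longrightarrow> k0 n = 0 \<Longrightarrow> op_norm (\<phi> n J - 1\<^sub>m n) \<le> \<epsilon> n"
    "\<And>n g h. n \<ge> 1 \<Longrightarrow> g \<in> carrier G \<Longrightarrow> h \<in> carrier G \<Longrightarrow> defect G (\<theta>0 n) g h \<le> ?bound n g h"
    "\<And>n. n \<ge> 1 \<Longrightarrow> op_norm (\<theta>0 n J - (- 1\<^sub>m (k0 n))) \<le> 2 * c n J + \<epsilon> n"
    by metis
  obtain r where r: "0 < r" "ereal r < liminf (\<lambda>n. ereal (op_norm (\<phi> n J - 1\<^sub>m n)))"
    using ereal_dense2[OF sep] by (auto simp: zero_ereal_def)
  have "eventually (\<lambda>n. r < op_norm (\<phi> n J - 1\<^sub>m n)) sequentially"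
    using less_LiminfD[OF r(2)] by simp
  moreover have "eventually (\<lambda>n. \<epsilon> n < r) sequentially" using order_tendstoD(2)[OF \<epsilon>_lim r(1)] .
  ultimately have good: "eventually (\<lambda>n. n \<ge> 1 \<and> k0 n \<noteq> 0) sequentially"
    using eventually_ge_at_top[of 1] by eventually_elim (use k0(2) in force)
  define bad where "bad n \<longleftrightarrow> n = 0 \<or> k0 n = 0" for n
  define k where "k n = (if bad n then 1 else k0 n)" for n
  define \<theta> where "\<theta> n = (if bad n then (\<lambda>_. 1\<^sub>m 1) else \<theta>0 n)" for n
  have not_bad: "eventually (\<lambda>n. \<not> bad n \<and> n \<ge> 1) sequentially"
    using good by eventually_elim (auto simp: bad_def)
  have "op_asymptotic_hom G k \<theta>" unfolding op_asymptotic_hom_def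
  proof (intro conjI allI ballI)
    show "k n > 0" for n unfolding k_def bad_def by auto
    show "\<theta> n \<in> carrier G \<rightarrow> carrier (unitary_group (k n))" for n
      using k0(1)[of n] unfolding k_def \<theta>_def bad_def by auto
    fix g h assume g: "g \<in> carrier G" and h: "h \<in> carrier G"
    have bound_lim: "(\<lambda>n. ?bound n g h) \<longlonglongrightarrow> 0"
      by (intro tendsto_add_zero tendsto_mult_right_zero c_lim lim m_closed g h)
    have le: "eventually (\<lambda>n. defect G (\<theta> n) g h \<le> ?bound n g h) sequentially"
      using not_bad by eventually_elim (use k0(3)[OF _ g h] in \<open>simp add: \<theta>_def\<close>)
    have nonneg: "eventually (\<lambda>n. 0 \<le> defect G (\<theta> n) g h) sequentially"
      unfolding defect_def by (simp add: op_norm_nonneg)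
    have "(\<lambda>n. defect G (\<theta> n) g h) \<longlonglongrightarrow> 0"
      by (rule tendsto_sandwich[OF nonneg le tendsto_const bound_lim])
    then show "(\<lambda>n. op_norm (\<theta> n (g \<otimes>\<^bsub>G\<^esub> h) - \<theta> n g * \<theta> n h)) \<longlonglongrightarrow> 0"
      unfolding defect_def .
  qed
  moreover have "(\<lambda>n. op_norm (\<theta> n J - (- 1\<^sub>m (k n)))) \<longlonglongrightarrow> 0"
  proof -
    have bound_lim: "(\<lambda>n. 2 * c n J + \<epsilon> n) \<longlonglongrightarrow> 0"
      by (intro tendsto_add_zero tendsto_mult_right_zero c_lim \<epsilon>_lim J(1))
    have le: "eventually (\<lambda>n. op_norm (\<theta> n J - (- 1\<^sub>m (k n))) \<le> 2 * c n J + \<epsilon> n) sequentially"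
      using not_bad by eventually_elim (use k0(4) in \<open>simp add: \<theta>_def k_def\<close>)
    have nonneg: "eventually (\<lambda>n. 0 \<le> op_norm (\<theta> n J - (- 1\<^sub>m (k n)))) sequentially"
      by (simp add: op_norm_nonneg)
    show ?thesis by (rule tendsto_sandwich[OF nonneg le tendsto_const bound_lim])
  qed
  ultimately show ?thesis by blast
qed

theorem proposition1p5:
  fixes \<Gamma> :: "('a, 'b) monoid_scheme"
  assumes "deligne_type \<Gamma>"
    and "\<And>(k :: nat \<Rightarrow> nat) (\<phi> :: nat \<Rightarrow> 'a \<Rightarrow> complex mat).
           op_asymptotic_hom \<Gamma> k \<phi> \<Longrightarrow>
           \<exists>\<psi> :: nat \<Rightarrow> 'a \<Rightarrow> complex mat.
             (\<forall>n. \<psi> n \<in> hom \<Gamma> (unitary_group (k n))) \<and>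
             (\<forall>x \<in> carrier \<Gamma>. (\<lambda>n. HS_norm (\<phi> n x - \<psi> n x)) \<longlonglongrightarrow> 0)"
  shows "\<not> MF \<Gamma>"
proof
  assume MF: "MF \<Gamma>"
  from assms(1) obtain J where fg: "finitely_generated_group \<Gamma>" and J: "J \<in> carrier \<Gamma>"
    and central: "\<And>g. g \<in> carrier \<Gamma> \<Longrightarrow> J \<otimes>\<^bsub>\<Gamma>\<^esub> g = g \<otimes>\<^bsub>\<Gamma>\<^esub> J"
    and ord: "group.ord \<Gamma> J = 2" and ker: "J \<in> ker_RF \<Gamma>"
    unfolding deligne_type_def by blast
  have G: "group \<Gamma>" using fg unfolding finitely_generated_group_def by blast
  interpret group \<Gamma> by (rule G)
  have JJ: "J \<otimes>\<^bsub>\<Gamma>\<^esub> J = \<one>\<^bsub>\<Gamma>\<^esub>"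
    using pow_ord_eq_1[OF J] J unfolding ord by (simp add: numeral_2_eq_2)
  have J1: "J \<noteq> \<one>\<^bsub>\<Gamma>\<^esub>" using ord by auto
  obtain k \<theta> where \<theta>: "op_asymptotic_hom \<Gamma> k \<theta>"
    and lim: "(\<lambda>n. op_norm (\<theta> n J - (- 1\<^sub>m (k n)))) \<longlonglongrightarrow> 0"
    using MF_involution_asymptotic_hom[OF G J JJ J1 central MF] by blast
  obtain \<psi> where \<psi>: "\<And>n. \<psi> n \<in> hom \<Gamma> (unitary_group (k n))"
    and HS: "(\<lambda>n. HS_norm (\<theta> n J - \<psi> n J)) \<longlonglongrightarrow> 0"
    using assms(2)[OF \<theta>] J by blast
  have \<psi>J: "\<psi> n J = 1\<^sub>m (k n)" for n by (rule hom_unitary_group_kills_ker_RF[OF fg \<psi> ker])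
  have "eventually (\<lambda>n. HS_norm (\<theta> n J - \<psi> n J) < 1) sequentially"
    using order_tendstoD(2)[OF HS] by simp
  moreover have "eventually (\<lambda>n. op_norm (\<theta> n J - (- 1\<^sub>m (k n))) < 1) sequentially"
    using order_tendstoD(2)[OF lim] by simp
  ultimately have "eventually (\<lambda>n. False) sequentially"
  proof eventually_elim
    case (elim n)
    have "\<theta> n J \<in> carrier_mat (k n) (k n)" "k n > 0"
      using \<theta> J unfolding op_asymptotic_hom_def by (auto simp: unitary_group_def)
    from HS_norm_minus_one_ge_1[OF this] elim show False unfolding \<psi>J by simp
  qed
  then show False by simp
qed

end
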